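(* Assume the setting, hypotheses on the coefficients $c$, and notation of the context. The series $\Phi_{\alpha,\beta}(t)=\sum_{m=1}^\infty K^{(m)}_{\alpha,\beta}(t)$ converges absolutely in $L^1([0,T])$ for every $\alpha,\beta\in\mathbb Z^d$ and every $T>0$. Furthermore, for every $T>0$ there is a constant $C_T$, independent of $\alpha,\beta,t$ and $\Delta x$, such that for all $\alpha,\beta\in\mathbb Z^d$ and $t\in(0,T]$, $$|\Phi_{\alpha,\beta}(t)|\le C_T\left(\frac1{\sqrt{2\overline c}}\wedge\frac{t^{1/2}}{\Delta x}\right)^{Z(\alpha-\beta)}t^{-(d+1)/2}\prod_{j=1}^d\left(1+\frac{|x^j_\alpha-x^j_\beta|^2}{2\overline c\,t}\right)^{-1}.$$
   Context: Grid. Let $d\ge1$, $\Delta x>0$, $x_\alpha=\alpha\,\Delta x$ for $\alpha\in\mathbb Z^d$, with $j$-th component $x^j_\alpha=\alpha^j\Delta x$. $\nabla_+^jf_\alpha=(f_{\alpha+e_j}-f_\alpha)/\Delta x$, $\nabla_-^jf_\alpha=(f_\alpha-f_{\alpha-e_j})/\Delta x$, with $e_j$ the canonical basis; for doubly indexed $F_{\alpha,\beta}$ the differences act only on $\alpha$. Discrete convolution: $(F\ast G)_{\alpha,\beta}=\sum_{\eta\in\mathbb Z^d}F_{\alpha,\eta}G_{\eta,\beta}\Delta x^d$. Discrete Dirac: $\delta_\alpha=\Delta x^{-d}$ if $\alpha=0$ and $0$ otherwise. $Z(\alpha)$ is the number of zero entries of $\alpha\in\mathbb Z^d$; $a\wedge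 b=\min(a,b)$. Coefficients (standing assumptions). $c^j=\{c^j_\alpha\}_{\alpha\in\mathbb Z^d}$, $j=1,\dots,d$, are bounded with $\inf_{\alpha,j}c^j_\alpha>0$ and $|c^j_\alpha-c^j_\beta|\le C|x_\alpha-x_\beta|$ for all $\alpha,\beta,j$, with $C$ independent of $\alpha,\beta,j$. Set $\overline c=\sup_{j,\alpha}c^j_\alpha$. "Independent of $\Delta x$" means that the constant depends only on $d$, $T$, the lower and upper bounds of the coefficients, and the Lipschitz constant $C$. Frozen-coefficient kernel. For fixed $\beta\in\mathbb Z^d$, $(\alpha,t)\mapsto a_{\alpha,\beta}(t)$ is the fundamental solution of the constant-coefficient equation with coefficients $c^1_\beta,\dots,c^d_\beta$: $\frac{d}{dt}a_{\alpha,\beta}=\sum_jc^j_\beta\nabla_+^j\nabla_-^ja_{\alpha,\beta}$, $a_{\alpha,\beta}(0)=\delta_\alpha$. Explicitly $a_{\alpha,\beta}(t)=\Delta x^{-d}\prod_{j=1}^de^{-r^j}I_{\alpha^j}(r^j)$, $r^j=2c^j_\beta t/\Delta x^2$, with $I_n$ the modified Bessel function of the first kind. Kernels. $K_{\alpha,\beta}(t)=\sum_{j=1}^d(c^j_\alpha-c^j_\beta)\nabla_+^j\nabla_-^ja_{\alpha-\beta,\beta}(t)$, differences in $\alpha$; $K^{(1)}=K$ and, for $m\ge2$, $K^{(m)}_{\alpha,\beta}(t)=\int_0^t(K(t-s)\ast K^{(m-1)}(s))_{\alpha,\beta}\,ds$. *)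

theory Defs
  imports "HOL-Analysis.Analysis"
begin

section \<open>Finite differences and convolution on the grid\<close>

text \<open>
  Grid functions are indexed by multi-indices of type \<open>int ^ 'd\<close>, so that the dimension is
  \<open>d = CARD('d) \<ge> 1\<close>; the mesh width is \<open>dx\<close> and \<open>axis j 1\<close> is the canonical basis vector \<open>e_j\<close>.
\<close>

definition gridpt :: "real \<Rightarrow> int ^ 'd \<Rightarrow> real ^ 'd" where
  "gridpt dx \<alpha> = (\<chi> j. of_int (\<alpha> $ j) * dx)"

definition diff_plus :: "real \<Rightarrow> 'd \<Rightarrow> (int ^ 'd \<Rightarrow> real) \<Rightarrow> int ^ 'd \<Rightarrow> real" where
  "diff_plus dx j f \<alpha> = (f (\<alpha> + axis j 1) - f \<alpha>) / dx"

definition diff_minus :: "real \<Rightarrow> 'd \<Rightarrow> (int ^ 'd \<Rightarrow> real) \<Rightarrow> int ^ 'd \<Rightarrow> real" where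
  "diff_minus dx j f \<alpha> = (f \<alpha> - f (\<alpha> - axis j 1)) / dx"

definition disc_conv ::
  "real \<Rightarrow> (int ^ 'd \<Rightarrow> int ^ 'd \<Rightarrow> real) \<Rightarrow> (int ^ 'd \<Rightarrow> int ^ 'd \<Rightarrow> real)
    \<Rightarrow> int ^ 'd \<Rightarrow> int ^ 'd \<Rightarrow> real" where
  "disc_conv dx F G \<alpha> \<beta> = (\<Sum>\<^sub>\<infinity>\<eta>. F \<alpha> \<eta> * G \<eta> \<beta> * dx ^ CARD('d))"

definition disc_dirac :: "real \<Rightarrow> int ^ 'd \<Rightarrow> real" where
  "disc_dirac dx \<alpha> = (if \<alpha> = 0 then inverse (dx ^ CARD('d)) else 0)"

definition zero_count :: "int ^ 'd \<Rightarrow> nat" where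
  "zero_count \<alpha> = card {j. \<alpha> $ j = 0}"

section \<open>Coefficients\<close>

text \<open>
  The grid point \<open>gridpt dx \<alpha>\<close> enters the Lipschitz condition through its Euclidean norm.
  Boundedness and positivity of the infimum are expressed by explicit bounds \<open>0 < lo\<close> and \<open>hi\<close>,
  on which constants are allowed to depend.
\<close>

definition admissible ::
  "real \<Rightarrow> real \<Rightarrow> real \<Rightarrow> real \<Rightarrow> ('d::finite \<Rightarrow> int ^ 'd \<Rightarrow> real) \<Rightarrow> bool" where
  "admissible dx lo hi L c \<longleftrightarrow>
     0 < dx \<and> 0 < lo \<and>
     (\<forall>j \<alpha>. lo \<le> c j \<alpha> \<and> c j \<alpha> \<le> hi) \<and>
     (\<forall>j \<alpha> \<beta>. \<bar>c j \<alpha> - c j \<beta>\<bar> \<le> L * norm (gridpt dx \<alpha> - gridpt dx \<beta>))"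

definition coeff_sup :: "('d::finite \<Rightarrow> int ^ 'd \<Rightarrow> real) \<Rightarrow> real" where
  "coeff_sup c = (SUP (j, \<alpha>) \<in> UNIV. c j \<alpha>)"

section \<open>Frozen-coefficient kernel\<close>

text \<open>Modified Bessel function of the first kind of integer order; note \<open>I_{-n} = I_n\<close>.\<close>

definition bessel_I :: "int \<Rightarrow> real \<Rightarrow> real" where
  "bessel_I n x = (\<Sum>k. (x / 2) ^ (2 * k + nat \<bar>n\<bar>) / (fact k * fact (k + nat \<bar>n\<bar>)))"

definition frozen_kernel ::
  "real \<Rightarrow> ('d::finite \<Rightarrow> int ^ 'd \<Rightarrow> real) \<Rightarrow> real \<Rightarrow> int ^ 'd \<Rightarrow> int ^ 'd \<Rightarrow> real" where
  "frozen_kernel dx c t \<alpha> \<beta> = inverse (dx ^ CARD('d)) *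
     (\<Prod>j\<in>UNIV. let r = 2 * c j \<beta> * t / dx\<^sup>2 in exp (- r) * bessel_I (\<alpha> $ j) r)"

section \<open>The parametrix kernels\<close>

definition param_kernel ::
  "real \<Rightarrow> ('d::finite \<Rightarrow> int ^ 'd \<Rightarrow> real) \<Rightarrow> real \<Rightarrow> int ^ 'd \<Rightarrow> int ^ 'd \<Rightarrow> real" where
  "param_kernel dx c t \<alpha> \<beta> =
     (\<Sum>j\<in>UNIV. (c j \<alpha> - c j \<beta>) *
        diff_plus dx j (diff_minus dx j (\<lambda>\<gamma>. frozen_kernel dx c t (\<gamma> - \<beta>) \<beta>)) \<alpha>)"

text \<open>
  The index is shifted: \<open>iter_kernel dx c m\<close> is the iterated kernel \<open>K^{(m+1)}\<close>, so that
  the series over \<open>m \<ge> 1\<close> of the \<open>K^{(m)}\<close> becomes a series over all natural numbers.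
\<close>

primrec iter_kernel ::
  "real \<Rightarrow> ('d::finite \<Rightarrow> int ^ 'd \<Rightarrow> real) \<Rightarrow> nat \<Rightarrow> real \<Rightarrow> int ^ 'd \<Rightarrow> int ^ 'd \<Rightarrow> real" where
  "iter_kernel dx c 0 = param_kernel dx c"
| "iter_kernel dx c (Suc m) = (\<lambda>t \<alpha> \<beta>.
     LBINT s:{0..t}. disc_conv dx (param_kernel dx c (t - s)) (iter_kernel dx c m s) \<alpha> \<beta>)"

definition param_series ::
  "real \<Rightarrow> ('d::finite \<Rightarrow> int ^ 'd \<Rightarrow> real) \<Rightarrow> real \<Rightarrow> int ^ 'd \<Rightarrow> int ^ 'd \<Rightarrow> real" where
  "param_series dx c t \<alpha> \<beta> = (\<Sum>m. iter_kernel dx c m t \<alpha> \<beta>)"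

text \<open>Absolute convergence of the series of the \<open>f m\<close> to \<open>F\<close> in the Banach space \<open>L^1([0,T])\<close>.\<close>

definition abs_sums_L1 :: "real \<Rightarrow> (nat \<Rightarrow> real \<Rightarrow> real) \<Rightarrow> (real \<Rightarrow> real) \<Rightarrow> bool" where
  "abs_sums_L1 T f F \<longleftrightarrow>
     (\<forall>m. set_integrable lborel {0..T} (f m)) \<and>
     summable (\<lambda>m. LBINT t:{0..T}. \<bar>f m t\<bar>) \<and>
     set_integrable lborel {0..T} F \<and>
     (\<lambda>n. LBINT t:{0..T}. \<bar>F t - (\<Sum>m<n. f m t)\<bar>) \<longlonglongrightarrow> 0"

section \<open>The explicit frozen kernel is a fundamental solution\<close>

lemma bessel_I_0: "bessel_I n 0 = (if n = 0 then 1 else 0)"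
proof -
  have "bessel_I n 0 = (\<Sum>k. if k = 0 then (if n = 0 then 1 else 0) else (0::real))"
    unfolding bessel_I_def by (rule suminf_cong) auto
  also have "\<dots> = (if n = 0 then 1 else 0)"
    using sums_single[of 0 "\<lambda>_. if n = 0 then 1 else (0::real)"] by (simp add: sums_iff)
  finally show ?thesis .
qed

definition bessel_aux :: "nat \<Rightarrow> real \<Rightarrow> real" where
  "bessel_aux n y = (\<Sum>k. inverse (fact k * fact (k + n)) * y ^ k)"

lemma bessel_aux_summable: "summable (\<lambda>k. inverse (fact k * fact (k + n)) * (y::real) ^ k)"
proof (rule summable_comparison_test')
  show "summable (\<lambda>k. inverse (fact k) * \<bar>y\<bar> ^ k)"
    by (rule summable_exp)
  fix k :: nat
  have "(1::real) \<le> fact (k + n)" by (rule fact_ge_1)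
  hence "inverse (fact (k + n)) \<le> (1::real)"
    by (simp add: inverse_le_1_iff)
  hence "inverse (fact k) * \<bar>y\<bar> ^ k * inverse (fact (k + n)) \<le> inverse (fact k) * \<bar>y\<bar> ^ k"
    by (intro mult_left_le) auto
  thus "norm (inverse (fact k * fact (k + n)) * y ^ k) \<le> inverse (fact k) * \<bar>y\<bar> ^ k"
    by (simp add: abs_mult power_abs mult_ac)
qed

lemma bessel_I_aux: "bessel_I (int n) x = (x / 2) ^ n * bessel_aux n ((x / 2)\<^sup>2)"
proof -
  have "bessel_I (int n) x =
    (\<Sum>k. (x / 2) ^ n * (inverse (fact k * fact (k + n)) * ((x / 2)\<^sup>2) ^ k))"
    unfolding bessel_I_def
  proof (rule suminf_cong)
    fix k
    have "(x / 2) ^ (2 * k + n) = (x / 2) ^ n * ((x / 2)\<^sup>2) ^ k"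
      unfolding power_add power_mult by (rule mult.commute)
    thus "(x / 2) ^ (2 * k + nat \<bar>int n\<bar>) / (fact k * fact (k + nat \<bar>int n\<bar>)) =
        (x / 2) ^ n * (inverse (fact k * fact (k + n)) * ((x / 2)\<^sup>2) ^ k)"
      by (simp only: abs_of_nat nat_int divide_inverse mult.assoc mult.left_commute mult.commute)
  qed
  also have "\<dots> = (x / 2) ^ n * bessel_aux n ((x / 2)\<^sup>2)"
    unfolding bessel_aux_def by (rule suminf_mult[OF bessel_aux_summable])
  finally show ?thesis .
qed

lemma bessel_aux_deriv: "(bessel_aux n has_real_derivative bessel_aux (Suc n) y) (at y)"
proof -
  have "diffs (\<lambda>k. inverse (fact k * fact (k + n)) :: real) =
        (\<lambda>k. inverse (fact k * fact (k + Suc n)))"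
  proof (rule ext)
    fix k
    have F: "fact (Suc k) = real (Suc k) * (fact k :: real)"
      by (rule fact_Suc)
    have "real (Suc k) * inverse (real (Suc k) * a * b) = inverse (a * b)" for a b :: real
      by (simp add: mult.assoc del: of_nat_Suc)
    thus "diffs (\<lambda>k. inverse (fact k * fact (k + n)) :: real) k =
        inverse (fact k * fact (k + Suc n))"
      unfolding diffs_def F by simp
  qed
  with termdiffs_strong_converges_everywhere
    [of "\<lambda>k. inverse (fact k * fact (k + n)) :: real" y, OF bessel_aux_summable]
  show ?thesis by (simp add: bessel_aux_def[abs_def])
qed

lemma bessel_aux_rec:
  "bessel_aux n y = (real n + 1) * bessel_aux (Suc n) y + y * bessel_aux (Suc (Suc n)) y"
proof -
  let ?a = "\<lambda>n k. inverse (fact k * fact (k + n)) * y ^ k :: real"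
  have rec: "?a n (Suc k) = (real n + 1) * ?a (Suc n) (Suc k) + y * ?a (Suc (Suc n)) k" for k
  proof -
    have 1: "fact (Suc k + Suc n) = (real k + real n + 2) * (fact (Suc k + n) :: real)"
      by (simp add: algebra_simps)
    have 2: "fact (k + Suc (Suc n)) = (real k + real n + 2) * (fact (Suc k + n) :: real)"
      by (simp add: algebra_simps)
    have 3: "fact (Suc k) = (real k + 1) * (fact k :: real)" by simp
    have alg: "inverse (a * G * F) * (y * z) =
        (b - a) * (inverse (a * G * (b * F)) * (y * z)) + y * (inverse (G * (b * F)) * z)"
      if "a \<noteq> 0" "b \<noteq> 0" for a b F G z :: real
    proof -
      have "inverse a = (b - a) * (inverse a * inverse b) + inverse b"
        using that by (simp add: field_simps)
      hence "inverse a * (inverse G * inverse F * y * z) =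
          ((b - a) * (inverse a * inverse b) + inverse b) * (inverse G * inverse F * y * z)"
        by (rule arg_cong)
      thus ?thesis by (simp only: inverse_mult_distrib ring_distribs mult_ac)
    qed
    have "real k + 1 \<noteq> 0" "real k + real n + 2 \<noteq> 0"
      by linarith+
    from alg[OF this, of "fact k" "fact (Suc k + n)" "y ^ k"]
    have "inverse ((real k + 1) * fact k * fact (Suc k + n)) * (y * y ^ k) =
        (real n + 1) * (inverse ((real k + 1) * fact k *
          ((real k + real n + 2) * fact (Suc k + n))) * (y * y ^ k)) +
        y * (inverse (fact k * ((real k + real n + 2) * fact (Suc k + n))) * y ^ k)"
      by (simp only: add_diff_eq diff_add_eq) (simp del: fact_Suc add_Suc add_Suc_right)
    thus ?thesis unfolding 1 2 3 power_Suc .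
  qed
  have zero: "?a n 0 = (real n + 1) * ?a (Suc n) 0"
    by (simp add: field_simps del: of_nat_Suc)
  have "bessel_aux n y = ?a n 0 + (\<Sum>k. ?a n (Suc k))"
    unfolding bessel_aux_def using suminf_split_head[OF bessel_aux_summable, of n y] by simp
  also have "(\<Sum>k. ?a n (Suc k)) =
      (\<Sum>k. (real n + 1) * ?a (Suc n) (Suc k) + y * ?a (Suc (Suc n)) k)"
    using rec by (simp only:)
  also have "\<dots> = (\<Sum>k. (real n + 1) * ?a (Suc n) (Suc k)) + (\<Sum>k. y * ?a (Suc (Suc n)) k)"
    using bessel_aux_summable[of "Suc n" y] bessel_aux_summable[of "Suc (Suc n)" y]
    by (intro suminf_add[symmetric] summable_mult) (subst summable_Suc_iff)
  also have "(\<Sum>k. y * ?a (Suc (Suc n)) k) = y * bessel_aux (Suc (Suc n)) y"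
    unfolding bessel_aux_def by (rule suminf_mult[OF bessel_aux_summable])
  also have "(\<Sum>k. (real n + 1) * ?a (Suc n) (Suc k)) = (real n + 1) * (\<Sum>k. ?a (Suc n) (Suc k))"
    using bessel_aux_summable[of "Suc n" y]
    by (intro suminf_mult) (subst summable_Suc_iff)
  also have "(\<Sum>k. ?a (Suc n) (Suc k)) = bessel_aux (Suc n) y - ?a (Suc n) 0"
    unfolding bessel_aux_def using suminf_split_head[OF bessel_aux_summable, of "Suc n" y] by simp
  finally show ?thesis unfolding zero by (simp add: algebra_simps)
qed

lemma bessel_I_minus: "bessel_I (- n) x = bessel_I n x"
  by (simp add: bessel_I_def)

lemma bessel_I_deriv:
  "(bessel_I n has_real_derivative (bessel_I (n + 1) x + bessel_I (n - 1) x) / 2) (at x)"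
proof -
  have nn: "(bessel_I (int m) has_real_derivative
      (bessel_I (int m + 1) x + bessel_I (int m - 1) x) / 2) (at x)" for m
  proof -
    have eq: "bessel_I (int m) = (\<lambda>x. (x / 2) ^ m * bessel_aux m ((x / 2)\<^sup>2))"
      by (rule ext) (rule bessel_I_aux)
    have aux: "((\<lambda>x. bessel_aux m ((x / 2)\<^sup>2)) has_real_derivative
        bessel_aux (Suc m) ((x / 2)\<^sup>2) * (x / 2)) (at x)"
      by (rule DERIV_chain2[OF bessel_aux_deriv])
         (auto intro!: derivative_eq_intros simp: power2_eq_square)
    have up: "bessel_I (int m + 1) x = (x / 2) ^ Suc m * bessel_aux (Suc m) ((x / 2)\<^sup>2)"
      using bessel_I_aux[of "Suc m" x] by (simp add: add.commute)
    show ?thesis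
    proof (cases m)
      case 0
      have "bessel_I (- 1) x = bessel_I 1 x" by (rule bessel_I_minus)
      with up have "bessel_I (int m + 1) x + bessel_I (int m - 1) x =
          x * bessel_aux (Suc m) ((x / 2)\<^sup>2)"
        by (simp add: 0)
      thus ?thesis using aux unfolding eq by (simp add: 0 mult.commute)
    next
      case (Suc l)
      have down: "bessel_I (int m - 1) x = (x / 2) ^ l * bessel_aux l ((x / 2)\<^sup>2)"
        using bessel_I_aux[of l x] by (simp add: Suc)
      have pow: "((\<lambda>x. (x / 2) ^ m) has_real_derivative real m * (x / 2) ^ l / 2) (at x)"
        by (rule DERIV_cong[OF DERIV_power[OF DERIV_cdivide[OF DERIV_ident]]]) (simp add: Suc)
      show ?thesis
        unfolding eq up down bessel_aux_rec[of l "(x / 2)\<^sup>2"]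
      proof (rule DERIV_cong[OF DERIV_mult[OF pow aux]])
        define A B y where "A = bessel_aux (Suc l) ((x / 2)\<^sup>2)"
          and "B = bessel_aux (Suc (Suc l)) ((x / 2)\<^sup>2)" and "y = x / 2"
        have "real (Suc l) * y ^ l / 2 * A + B * y * y ^ Suc l =
          (y ^ Suc (Suc l) * B + y ^ l * ((real l + 1) * A + y\<^sup>2 * B)) / 2"
          by (simp add: field_simps power2_eq_square)
        thus "real m * (x / 2) ^ l / 2 * bessel_aux m ((x / 2)\<^sup>2) +
            bessel_aux (Suc m) ((x / 2)\<^sup>2) * (x / 2) * (x / 2) ^ m =
          ((x / 2) ^ Suc m * bessel_aux (Suc m) ((x / 2)\<^sup>2) +
            (x / 2) ^ l * ((real l + 1) * bessel_aux (Suc l) ((x / 2)\<^sup>2) +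
              (x / 2)\<^sup>2 * bessel_aux (Suc (Suc l)) ((x / 2)\<^sup>2))) / 2"
          unfolding Suc A_def B_def y_def .
      qed
    qed
  qed
  show ?thesis
  proof (cases "n \<ge> 0")
    case True
    thus ?thesis using nn[of "nat n"] by simp
  next
    case False
    define m where "m = nat (- n)"
    have n: "n = - int m" using False by (simp add: m_def)
    have f: "bessel_I n = bessel_I (int m)"
      unfolding n by (rule ext) (rule bessel_I_minus)
    have up: "bessel_I (n + 1) x = bessel_I (int m - 1) x"
      using bessel_I_minus[of "int m - 1" x] by (simp add: n)
    have down: "bessel_I (n - 1) x = bessel_I (int m + 1) x"
      using bessel_I_minus[of "int m + 1" x] by (simp add: n)
    show ?thesis
      unfolding f up down using nn[of m] by (simp only: add.commute)
  qed
qed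

lemma frozen_kernel_initial: "frozen_kernel dx c 0 \<alpha> \<beta> = disc_dirac dx \<alpha>"
proof (cases "\<alpha> = 0")
  case True
  thus ?thesis by (simp add: frozen_kernel_def disc_dirac_def bessel_I_0)
next
  case False
  then obtain j where "\<alpha> $ j \<noteq> 0" by (auto simp: vec_eq_iff)
  hence "(\<Prod>j\<in>UNIV. bessel_I (\<alpha> $ j) 0) = 0"
    by (intro prod_zero) (auto simp: bessel_I_0)
  with False show ?thesis by (simp add: frozen_kernel_def disc_dirac_def)
qed

lemma frozen_kernel_equation:
  assumes "dx \<noteq> 0"
  shows "((\<lambda>t. frozen_kernel dx c t \<alpha> \<beta>) has_real_derivative
    (\<Sum>j\<in>UNIV. c j \<beta> * diff_plus dx j (diff_minus dx j (\<lambda>\<gamma>. frozen_kernel dx c t \<gamma> \<beta>)) \<alpha>)) (at t)"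
proof -
  define p where "p j n s = (let r = 2 * c j \<beta> * s / dx\<^sup>2 in exp (- r) * bessel_I n r)" for j n s
  define D where "D = inverse (dx ^ CARD('a))"
  have fk: "frozen_kernel dx c s \<gamma> \<beta> = D * (\<Prod>j\<in>UNIV. p j (\<gamma> $ j) s)" for s \<gamma>
    by (simp add: frozen_kernel_def p_def D_def)
  have p: "(p j n has_real_derivative
      c j \<beta> / dx\<^sup>2 * (p j (n + 1) t + p j (n - 1) t - 2 * p j n t)) (at t)" for j n
  proof -
    let ?r = "\<lambda>s. 2 * c j \<beta> * s / dx\<^sup>2"
    have r: "(?r has_real_derivative 2 * c j \<beta> / dx\<^sup>2) (at t)"
      using assms by (auto intro!: derivative_eq_intros simp: divide_simps)
    have b: "((\<lambda>s. bessel_I n (?r s)) has_real_derivative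
        (bessel_I (n + 1) (?r t) + bessel_I (n - 1) (?r t)) / 2 * (2 * c j \<beta> / dx\<^sup>2)) (at t)"
      by (rule DERIV_chain2[OF bessel_I_deriv r])
    have e: "((\<lambda>s. exp (- ?r s)) has_real_derivative
        exp (- ?r t) * - (2 * c j \<beta> / dx\<^sup>2)) (at t)"
      by (rule DERIV_chain2[OF DERIV_exp DERIV_minus[OF r]])
    have "((\<lambda>s. exp (- ?r s) * bessel_I n (?r s)) has_real_derivative
        c j \<beta> / dx\<^sup>2 * (p j (n + 1) t + p j (n - 1) t - 2 * p j n t)) (at t)"
    proof (rule DERIV_cong[OF DERIV_mult[OF e b]])
      have "E * - (2 * k) * B + (B1 + B2) / 2 * (2 * k) * E = k * (E * B1 + E * B2 - 2 * (E * B))"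
        for E B B1 B2 k :: real
        by (simp add: algebra_simps)
      from this[where k = "c j \<beta> / dx\<^sup>2"]
      show "exp (- ?r t) * - (2 * c j \<beta> / dx\<^sup>2) * bessel_I n (?r t) +
          (bessel_I (n + 1) (?r t) + bessel_I (n - 1) (?r t)) / 2 * (2 * c j \<beta> / dx\<^sup>2) *
          exp (- ?r t) =
          c j \<beta> / dx\<^sup>2 * (p j (n + 1) t + p j (n - 1) t - 2 * p j n t)"
        unfolding p_def Let_def by (simp only: times_divide_eq_right)
    qed
    thus ?thesis by (simp add: p_def[abs_def] Let_def)
  qed
  have shift: "frozen_kernel dx c t (\<alpha> + k *s axis j 1) \<beta> =
      D * (p j (\<alpha> $ j + k) t * (\<Prod>i\<in>UNIV - {j}. p i (\<alpha> $ i) t))" for j and k :: int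
    unfolding fk by (subst prod.remove[of UNIV j]) (auto simp: axis_def intro!: prod.cong)
  have neg: "\<alpha> + - 1 *s axis j 1 = \<alpha> - axis j 1" for j
    by (simp add: vec_eq_iff)
  have lap: "diff_plus dx j (diff_minus dx j (\<lambda>\<gamma>. frozen_kernel dx c t \<gamma> \<beta>)) \<alpha> =
      D * ((p j (\<alpha> $ j + 1) t + p j (\<alpha> $ j - 1) t - 2 * p j (\<alpha> $ j) t) / dx\<^sup>2 *
        (\<Prod>i\<in>UNIV - {j}. p i (\<alpha> $ i) t))" for j
  proof -
    have 1: "frozen_kernel dx c t (\<alpha> + axis j 1) \<beta> =
        D * (p j (\<alpha> $ j + 1) t * (\<Prod>i\<in>UNIV - {j}. p i (\<alpha> $ i) t))"
      using shift[of 1 j] by simp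
    have 2: "frozen_kernel dx c t (\<alpha> - axis j 1) \<beta> =
        D * (p j (\<alpha> $ j - 1) t * (\<Prod>i\<in>UNIV - {j}. p i (\<alpha> $ i) t))"
      using shift[of "-1" j] unfolding neg by simp
    have 3: "frozen_kernel dx c t \<alpha> \<beta> =
        D * (p j (\<alpha> $ j) t * (\<Prod>i\<in>UNIV - {j}. p i (\<alpha> $ i) t))"
      using shift[of 0 j] by simp
    have "((D * (P1 * Q) - D * (P0 * Q)) / dx - (D * (P0 * Q) - D * (P2 * Q)) / dx) / dx =
        D * ((P1 + P2 - 2 * P0) / dx\<^sup>2 * Q)" for P0 P1 P2 Q
      using assms by (simp add: divide_simps power2_eq_square) (simp add: algebra_simps)
    thus ?thesis
      unfolding diff_plus_def diff_minus_def by (simp only: 1 2 3 add_diff_cancel)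
  qed
  have "((\<lambda>s. D * (\<Prod>j\<in>UNIV. p j (\<alpha> $ j) s)) has_real_derivative
      D * (\<Sum>j\<in>UNIV. c j \<beta> / dx\<^sup>2 *
        (p j (\<alpha> $ j + 1) t + p j (\<alpha> $ j - 1) t - 2 * p j (\<alpha> $ j) t) *
        (\<Prod>i\<in>UNIV - {j}. p i (\<alpha> $ i) t))) (at t)"
    by (intro DERIV_cmult has_field_derivative_prod p)
  thus ?thesis
    unfolding fk[symmetric] lap by (simp add: sum_distrib_left mult_ac)
qed

end

theory Submission
  imports Defs
begin

text \<open>
  Write \<open>q_n(r) = exp (- r) I_n(r)\<close>, the law at time \<open>r\<close> of a symmetric continuous-time random walk, and
  \<open>s(t) = sqrt (2 c t) / dx\<close> with \<open>c\<close> the supremum of the coefficients. Up to a constant, the claimed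
  bound is \<open>1 / sqrt t\<close> times the product over the coordinates of the profiles \<open>p_s(n) / dx\<close>, where
  \<open>p_s(0) = 1 / max 1 s\<close> and \<open>p_s(n) = s / (s\<^sup>2 + n\<^sup>2)\<close> for \<open>n \<noteq> 0\<close>: this is a discrete version of
  the Poisson kernel, with the value at \<open>0\<close> capped so that the total mass stays bounded when the
  diffusion has not yet left a single cell. The different treatment of \<open>n = 0\<close> is what the factor
  with exponent \<open>Z(\<alpha> - \<beta>)\<close> records. Three facts carry the proof.

  First, the kernel \<open>K\<close> satisfies the claimed bound. By the Lipschitz condition
  \<open>\<bar>c_\<alpha> - c_\<beta>\<bar>\<close> costs a factor \<open>dx \<bar>\<alpha> - \<beta>\<bar>\<close>, so one needs \<open>q\<close>, \<open>n q\<close>, the second difference of \<open>q\<close>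
  and its product with \<open>n\<close> to be dominated by \<open>p\<close>, \<open>s p\<close>, \<open>p / s\<^sup>2\<close> and \<open>p / s\<close>. These bounds follow by
  interpolation from decay in \<open>r\<close> and from the cubic moments \<open>\<bar>n\<bar>\<^sup>3 q_n(r) \<le> 12 r\<close> and
  \<open>\<bar>n\<bar>\<^sup>3 \<bar>q_{n+1} - 2 q_n + q_{n-1}\<bar> \<le> 96\<close>, which come out of three integrations by parts in
  the cosine integral \<open>q_n(r) = (1 / \<pi>) \<integral>\<^sub>0\<^sup>\<pi> exp (- r (1 - cos \<theta>)) cos (n \<theta>) d\<theta>\<close>
  (\<open>walk_tail\<close>, \<open>walk_lap_tail\<close>, \<open>param_kernel_bound\<close>).

  Second, the profiles are almost a convolution semigroup in \<open>s\<^sup>2\<close>: their convolution at scales \<open>s\<close>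
  and \<open>t\<close> is at most a constant times the profile at scale \<open>\<rho> = sqrt (s\<^sup>2 + t\<^sup>2)\<close>, because of the
  pointwise inequality \<open>min (p_s a) (p_t b) \<le> 8 p_\<rho> (a + b)\<close> and the uniform bound on the mass
  (\<open>profile_min\<close>, \<open>grid_profile_conv\<close>). Since \<open>s(t)\<^sup>2\<close> is linear in \<open>t\<close>, the spatial part of the bound
  is reproduced, up to a constant, by every convolution in space and time.

  Third, what is left in time is iterated convolution with \<open>1 / sqrt t\<close> on \<open>(0, T]\<close>, which is a
  contraction for the norm weighted by \<open>exp (- \<mu> t)\<close> if \<open>\<mu>\<close> is large. Thus each iteration gains a
  factor \<open>1 / 2\<close> over the bound for \<open>K\<close> times \<open>exp (\<mu> t)\<close>, where \<open>\<mu>\<close> depends only on \<open>T\<close>, the dimension,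
  the bounds on the coefficients and their Lipschitz constant (\<open>iter_kernel_bound\<close>), and the series is
  dominated by a geometric one.
\<close>

section \<open>The cosine integral of the modified Bessel functions\<close>

definition bessel_int :: "int \<Rightarrow> real \<Rightarrow> real" where
  "bessel_int n x = integral {0..pi} (\<lambda>\<theta>. exp (x * cos \<theta>) * cos (of_int n * \<theta>)) / pi"

lemma bessel_int_deriv:
  "(bessel_int n has_real_derivative (bessel_int (n + 1) x + bessel_int (n - 1) x) / 2) (at x)"
proof -
  have int: "(\<lambda>\<theta>. exp (x * cos \<theta>) * cos (of_int m * \<theta>)) integrable_on {0..pi}" for m :: int and x :: real
    by (intro integrable_continuous_real continuous_intros)
  have "((\<lambda>x. integral (cbox 0 pi) (\<lambda>\<theta>. exp (x * cos \<theta>) * cos (of_int n * \<theta>)))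
      has_field_derivative
      integral (cbox 0 pi) (\<lambda>\<theta>. exp (x * cos \<theta>) * cos \<theta> * cos (of_int n * \<theta>))) (at x within UNIV)"
  proof (rule leibniz_rule_field_derivative)
    fix x \<theta> :: real
    show "((\<lambda>x. exp (x * cos \<theta>) * cos (of_int n * \<theta>)) has_field_derivative
        exp (x * cos \<theta>) * cos \<theta> * cos (of_int n * \<theta>)) (at x within UNIV)"
      by (auto intro!: derivative_eq_intros)
    show "(\<lambda>\<theta>. exp (x * cos \<theta>) * cos (of_int n * \<theta>)) integrable_on cbox 0 pi"
      using int[of x n] by simp
  next
    show "continuous_on (UNIV \<times> cbox 0 pi)
        (\<lambda>(x, \<theta>). exp (x * cos \<theta>) * cos \<theta> * cos (of_int n * \<theta>))"
      unfolding split_beta by (intro continuous_intros)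
  qed auto
  also have "(\<lambda>\<theta>. exp (x * cos \<theta>) * cos \<theta> * cos (of_int n * \<theta>)) =
      (\<lambda>\<theta>. (exp (x * cos \<theta>) * cos (of_int (n + 1) * \<theta>) + exp (x * cos \<theta>) * cos (of_int (n - 1) * \<theta>)) / 2)"
    by (rule ext) (simp add: ring_distribs cos_add cos_diff)
  also have "integral (cbox 0 pi) \<dots> = pi * (bessel_int (n + 1) x + bessel_int (n - 1) x) / 2"
    using int[of x "n + 1"] int[of x "n - 1"]
    by (simp add: bessel_int_def integral_add ring_distribs)
  finally have "((\<lambda>x. pi * bessel_int n x) has_real_derivative
      pi * (bessel_int (n + 1) x + bessel_int (n - 1) x) / 2) (at x)"
    by (simp add: bessel_int_def)
  from DERIV_cdivide[OF this, of pi] show ?thesis by simp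
qed

lemma bessel_int_0: "bessel_int n 0 = (if n = 0 then 1 else 0)"
proof (cases "n = 0")
  case False
  have "((\<lambda>\<theta>. cos (of_int n * \<theta>)) has_integral
      sin (of_int n * pi) / of_int n - sin (of_int n * 0) / of_int n) {0..pi}"
    using False
    by (intro fundamental_theorem_of_calculus)
      (auto intro!: derivative_eq_intros simp: has_real_derivative_iff_has_vector_derivative[symmetric])
  moreover have "sin (of_int n * pi) = 0"
    using sin_times_pi_eq_0[of "of_int n"] by auto
  ultimately show ?thesis using False by (simp add: bessel_int_def integral_unique)
qed (simp add: bessel_int_def)

lemma bessel_int_bound:
  assumes "0 \<le> x"
  shows "\<bar>bessel_int n x\<bar> \<le> exp x"
proof -
  have "norm (integral {0..pi} (\<lambda>\<theta>. exp (x * cos \<theta>) * cos (of_int n * \<theta>))) \<le> exp x * (pi - 0)"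
  proof (rule integral_bound)
    fix \<theta> :: real
    have "x * cos \<theta> \<le> x * 1" using assms by (intro mult_left_mono) auto
    hence "exp (x * cos \<theta>) * \<bar>cos (of_int n * \<theta>)\<bar> \<le> exp x * 1"
      by (intro mult_mono) auto
    thus "norm (exp (x * cos \<theta>) * cos (of_int n * \<theta>)) \<le> exp x"
      by (simp add: abs_mult)
  qed (auto intro!: continuous_intros)
  thus ?thesis by (simp add: bessel_int_def field_simps)
qed

lemma power_over_fact_le_exp:
  assumes "0 \<le> (x::real)" shows "x ^ n / fact n \<le> exp x"
proof -
  have "sum (\<lambda>k. x ^ k / fact k) {n} \<le> (\<Sum>k. x ^ k / fact k)"
    using assms summable_exp[of x] by (intro sum_le_suminf) (auto simp: field_simps)
  thus ?thesis by (simp add: exp_def field_simps)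
qed

text \<open>
  A bound that is uniform in the order \<open>n\<close>, as required by \<open>lattice_ode_unique\<close> below; it comes from
  \<open>y\<^sup>n / fact n \<le> exp y\<close>.
\<close>
lemma bessel_I_bound:
  assumes "0 \<le> x"
  shows "\<bar>bessel_I n x\<bar> \<le> exp (x / 2) * exp ((x / 2)\<^sup>2)"
proof -
  let ?m = "nat \<bar>n\<bar>" and ?y = "(x / 2)\<^sup>2"
  have "bessel_I n x = bessel_I (int ?m) x"
    by (simp add: bessel_I_def)
  also have "\<dots> = (x / 2) ^ ?m * bessel_aux ?m ?y" by (rule bessel_I_aux)
  finally have eq: "bessel_I n x = (x / 2) ^ ?m * bessel_aux ?m ?y" .
  have pos: "0 \<le> bessel_aux ?m ?y"
    unfolding bessel_aux_def by (intro suminf_nonneg bessel_aux_summable) auto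
  have "bessel_aux ?m ?y \<le> (\<Sum>k. (1 / fact ?m) * (inverse (fact k) * ?y ^ k))"
    unfolding bessel_aux_def
  proof (rule suminf_le)
    fix k
    have "inverse (fact (k + ?m)) \<le> 1 / (fact ?m :: real)"
      by (simp add: inverse_eq_divide frac_le fact_mono)
    hence "inverse (fact (k + ?m)) * (inverse (fact k) * ?y ^ k) \<le> 1 / fact ?m * (inverse (fact k) * ?y ^ k)"
      by (rule mult_right_mono) auto
    thus "inverse (fact k * fact (k + ?m)) * ?y ^ k \<le> 1 / fact ?m * (inverse (fact k) * ?y ^ k)"
      by (simp add: mult_ac)
  qed (intro bessel_aux_summable summable_mult summable_exp)+
  also have "\<dots> = exp ?y / fact ?m"
    unfolding suminf_mult[OF summable_exp] by (simp add: exp_def del: power_divide)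
  finally have "(x / 2) ^ ?m * bessel_aux ?m ?y \<le> (x / 2) ^ ?m * (exp ?y / fact ?m)"
    using assms by (intro mult_left_mono) auto
  also have "\<dots> = ((x / 2) ^ ?m / fact ?m) * exp ?y" by simp
  also have "\<dots> \<le> exp (x / 2) * exp ?y"
    using assms by (intro mult_right_mono power_over_fact_le_exp) auto
  finally show ?thesis using eq pos assms by simp
qed

text \<open>
  The right-hand side averages two neighbours, so it does not increase a bound that is uniform in \<open>n\<close>.
  Integrating \<open>k\<close> times from the zero initial value improves the bound \<open>B\<close> to \<open>B x\<^sup>k / fact k\<close>, which
  tends to \<open>0\<close>.
\<close>
lemma lattice_ode_unique:
  fixes E :: "int \<Rightarrow> real \<Rightarrow> real"
  assumes deriv: "\<And>n x. (E n has_real_derivative (E (n + 1) x + E (n - 1) x) / 2) (at x)"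
    and init: "\<And>n. E n 0 = 0"
    and bound: "\<And>n x. 0 \<le> x \<Longrightarrow> x \<le> X \<Longrightarrow> \<bar>E n x\<bar> \<le> B"
    and "0 \<le> X"
  shows "E n X = 0"
proof -
  have iter: "\<bar>E n x\<bar> \<le> B * (x ^ k / fact k)" if "0 \<le> x" "x \<le> X" for n x k
    using that
  proof (induction k arbitrary: n x)
    case 0
    thus ?case using bound by simp
  next
    case (Suc k)
    \<comment> \<open>The two signs give the upper and the lower bound for \<open>E n x\<close>.\<close>
    have "0 \<le> B * (x ^ Suc k / fact (Suc k)) + s * E n x" if s: "s \<in> {-1, 1}" for s
    proof -
      have avg: "0 \<le> b + s * ((p + q) / 2)" if "\<bar>p\<bar> \<le> b" "\<bar>q\<bar> \<le> b" for b p q :: real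
        using s that by (auto simp: abs_le_iff field_simps)
      let ?g = "\<lambda>y. B * (y ^ Suc k / fact (Suc k)) + s * E n y"
      have "?g 0 \<le> ?g x"
      proof (rule DERIV_nonneg_imp_nondecreasing[OF Suc.prems(1)])
        fix y assume y: "0 \<le> y" "y \<le> x"
        have F: "fact (Suc k) = real (Suc k) * (fact k :: real)" by (rule fact_Suc)
        have "((\<lambda>y. y ^ Suc k / fact (Suc k)) has_real_derivative real (Suc k) * y ^ k / fact (Suc k)) (at y)"
          by (rule DERIV_cong[OF DERIV_cdivide[OF DERIV_power[OF DERIV_ident]]]) simp
        hence 1: "((\<lambda>y. y ^ Suc k / fact (Suc k)) has_real_derivative y ^ k / fact k) (at y)"
          unfolding F by (simp del: of_nat_Suc power_Suc)
        have "(?g has_real_derivative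
            B * (y ^ k / fact k) + s * ((E (n + 1) y + E (n - 1) y) / 2)) (at y)"
          by (intro DERIV_add DERIV_cmult 1 deriv)
        moreover have "\<bar>E (n + 1) y\<bar> \<le> B * (y ^ k / fact k)" "\<bar>E (n - 1) y\<bar> \<le> B * (y ^ k / fact k)"
          using y Suc.prems by (intro Suc.IH; simp)+
        hence "0 \<le> B * (y ^ k / fact k) + s * ((E (n + 1) y + E (n - 1) y) / 2)"
          by (rule avg)
        ultimately show "\<exists>D. (?g has_real_derivative D) (at y) \<and> 0 \<le> D" by blast
      qed
      thus ?thesis by (simp add: init)
    qed
    from this[of 1] this[of "-1"] show ?case by auto
  qed
  have "(\<lambda>k. B * (X ^ k / fact k)) \<longlonglongrightarrow> B * 0"
    using summable_LIMSEQ_zero[OF summable_exp[of X]]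
    by (intro tendsto_mult_left) (simp add: divide_inverse mult.commute)
  hence "\<bar>E n X\<bar> \<le> B * 0"
    by (rule LIMSEQ_le_const) (use iter[OF \<open>0 \<le> X\<close> order_refl] in blast)
  thus ?thesis by simp
qed

text \<open>
  Both sides solve the same differential-difference equation with the same initial value, and both are
  bounded uniformly in \<open>n\<close> on \<open>[0, x]\<close>.
\<close>
lemma bessel_I_integral:
  assumes "0 \<le> x"
  shows "bessel_I n x = integral {0..pi} (\<lambda>\<theta>. exp (x * cos \<theta>) * cos (of_int n * \<theta>)) / pi"
proof -
  let ?E = "\<lambda>n x. bessel_I n x - bessel_int n x"
  have "?E n x = 0"
  proof (rule lattice_ode_unique[where E = ?E and X = x and B = "exp (x / 2) * exp ((x / 2)\<^sup>2) + exp x"])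
    show "(?E m has_real_derivative (?E (m + 1) y + ?E (m - 1) y) / 2) (at y)" for m y
      by (rule DERIV_cong[OF DERIV_diff[OF bessel_I_deriv bessel_int_deriv]]) (simp add: field_simps)
    show "?E m 0 = 0" for m by (simp add: bessel_I_0 bessel_int_0)
    fix m y assume y: "0 \<le> y" "y \<le> x"
    have "exp (y / 2) * exp ((y / 2)\<^sup>2) \<le> exp (x / 2) * exp ((x / 2)\<^sup>2)"
      using y by (intro mult_mono) (auto intro!: power_mono)
    moreover have "exp y \<le> exp x" using y by simp
    ultimately show "\<bar>?E m y\<bar> \<le> exp (x / 2) * exp ((x / 2)\<^sup>2) + exp x"
      using bessel_I_bound[OF y(1), of m] bessel_int_bound[OF y(1), of m] by linarith
  qed (rule assms)
  thus ?thesis by (simp add: bessel_int_def)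
qed

section \<open>Decay of the random walk kernel in time and space\<close>

text \<open>
  The probability that a symmetric nearest-neighbour walk on the integers with jump rate \<open>1\<close> has moved
  by \<open>n\<close> at time \<open>r\<close>.
\<close>
definition walk :: "int \<Rightarrow> real \<Rightarrow> real" where
  "walk n r = exp (- r) * bessel_I n r"

definition walk_lap :: "int \<Rightarrow> real \<Rightarrow> real" where
  "walk_lap n r = walk (n + 1) r + walk (n - 1) r - 2 * walk n r"

lemma walk_integral:
  assumes "0 \<le> r"
  shows "walk n r = integral {0..pi} (\<lambda>\<theta>. exp (- r * (1 - cos \<theta>)) * cos (of_int n * \<theta>)) / pi"
proof -
  have "(\<lambda>\<theta>. exp (- r * (1 - cos \<theta>)) * cos (of_int n * \<theta>)) =
      (\<lambda>\<theta>. exp (- r) * (exp (r * cos \<theta>) * cos (of_int n * \<theta>)))"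
    by (rule ext) (simp add: algebra_simps flip: exp_add)
  thus ?thesis using assms by (simp add: walk_def bessel_I_integral)
qed

lemma walk_lap_integral:
  assumes "0 \<le> r"
  shows "walk_lap n r =
    - 2 * integral {0..pi} (\<lambda>\<theta>. (1 - cos \<theta>) * exp (- r * (1 - cos \<theta>)) * cos (of_int n * \<theta>)) / pi"
proof -
  let ?f = "\<lambda>m \<theta>. exp (- r * (1 - cos \<theta>)) * cos (of_int m * \<theta>)"
  have int: "?f m integrable_on {0..pi}" for m :: int
    by (intro integrable_continuous_real continuous_intros)
  have "walk_lap n r = (integral {0..pi} (?f (n + 1)) + integral {0..pi} (?f (n - 1)) -
      2 * integral {0..pi} (?f n)) / pi"
    using assms by (simp add: walk_lap_def walk_integral diff_divide_distrib add_divide_distrib)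
  also have "integral {0..pi} (?f (n + 1)) + integral {0..pi} (?f (n - 1)) -
      2 * integral {0..pi} (?f n) = integral {0..pi} (\<lambda>\<theta>. ?f (n + 1) \<theta> + ?f (n - 1) \<theta> - 2 * ?f n \<theta>)"
    unfolding integral_add[OF int int, symmetric] integral_mult_right[symmetric]
    by (intro integral_diff[symmetric] integrable_add integrable_on_mult_right int)
  also have "(\<lambda>\<theta>. ?f (n + 1) \<theta> + ?f (n - 1) \<theta> - 2 * ?f n \<theta>) =
      (\<lambda>\<theta>. - 2 * ((1 - cos \<theta>) * exp (- r * (1 - cos \<theta>)) * cos (of_int n * \<theta>)))"
    by (rule ext) (simp add: ring_distribs cos_add cos_diff)
  finally show ?thesis by simp
qed

text \<open>
  From \<open>y cos y \<le> sin y\<close> at \<open>y = x / 2\<close> and the double angle formula, since \<open>(cos (x / 2))\<^sup>2 \<ge> 1 / 2\<close>.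
\<close>
lemma sin_ge_half:
  assumes "0 \<le> x" "x \<le> pi / 2"
  shows "x / 2 \<le> sin (x::real)"
proof -
  have "0 * cos 0 - sin 0 \<ge> (x / 2) * cos (x / 2) - sin (x / 2)"
  proof (rule DERIV_nonpos_imp_nonincreasing[where f = "\<lambda>y. y * cos y - sin y"])
    fix y :: real assume y: "0 \<le> y" "y \<le> x / 2"
    have "((\<lambda>y. y * cos y - sin y) has_real_derivative - (y * sin y)) (at y)"
      by (auto intro!: derivative_eq_intros)
    moreover have "0 \<le> sin y" using y assms by (intro sin_ge_zero) auto
    ultimately show "\<exists>D. ((\<lambda>y. y * cos y - sin y) has_real_derivative D) (at y) \<and> D \<le> 0"
      using y by fastforce
  qed (use assms in simp)
  hence 1: "(x / 2) * cos (x / 2) \<le> sin (x / 2)" by simp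
  have 2: "0 \<le> cos (x / 2)" using assms pi_gt_zero by (intro cos_ge_zero) auto
  have "cos x = 2 * (cos (x / 2))\<^sup>2 - 1" using cos_double_cos[of "x / 2"] by simp
  moreover have "0 \<le> cos x" using assms by (intro cos_ge_zero) auto
  ultimately have 3: "1 / 2 \<le> (cos (x / 2))\<^sup>2" by simp
  have "x / 2 \<le> x * (cos (x / 2))\<^sup>2" using mult_left_mono[OF 3 assms(1)] by simp
  also have "\<dots> = 2 * ((x / 2) * cos (x / 2)) * cos (x / 2)" by (simp add: power2_eq_square)
  also have "\<dots> \<le> 2 * sin (x / 2) * cos (x / 2)"
    using 1 2 by (intro mult_right_mono) auto
  also have "\<dots> = sin x" using sin_double[of "x / 2"] by simp
  finally show ?thesis .
qed

lemma one_minus_cos_ge: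
  assumes "0 \<le> x" "x \<le> pi"
  shows "x\<^sup>2 / 8 \<le> 1 - cos (x::real)"
proof -
  have "x / 2 / 2 \<le> sin (x / 2)" using assms by (intro sin_ge_half) auto
  hence "(x / 2 / 2)\<^sup>2 \<le> (sin (x / 2))\<^sup>2" using assms by (intro power_mono) auto
  moreover have "cos x = 1 - 2 * (sin (x / 2))\<^sup>2" using cos_double_sin[of "x / 2"] by simp
  ultimately show ?thesis by (simp add: power2_eq_square)
qed

text \<open>
  The Gaussian behaviour of the integrand near \<open>\<theta> = 0\<close> gives the order \<open>1 / sqrt a\<close>. Replacing
  \<open>exp (- y)\<close> by \<open>1 / (1 + y)\<close> keeps this order and makes the integral an arctangent.
\<close>
lemma integral_exp_one_minus_cos:
  assumes "0 < a"
  shows "integral {0..pi} (\<lambda>\<theta>. exp (- a * (1 - cos \<theta>))) \<le> pi * sqrt 2 / sqrt a"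
proof -
  define b where "b = a / 8"
  have b: "0 < b" using assms by (simp add: b_def)
  have int: "((\<lambda>\<theta>. inverse (1 + b * \<theta>\<^sup>2)) has_integral
      arctan (sqrt b * pi) / sqrt b - arctan (sqrt b * 0) / sqrt b) {0..pi}"
  proof (rule fundamental_theorem_of_calculus)
    fix \<theta> :: real
    have "((\<lambda>\<theta>. arctan (sqrt b * \<theta>) / sqrt b) has_real_derivative inverse (1 + b * \<theta>\<^sup>2)) (at \<theta>)"
      using b by (auto intro!: derivative_eq_intros simp: power_mult_distrib real_sqrt_mult_self mult.assoc)
    thus "((\<lambda>\<theta>. arctan (sqrt b * \<theta>) / sqrt b) has_vector_derivative inverse (1 + b * \<theta>\<^sup>2))
        (at \<theta> within {0..pi})"
      by (simp add: has_real_derivative_iff_has_vector_derivative has_vector_derivative_at_within)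
  qed simp
  have "integral {0..pi} (\<lambda>\<theta>. exp (- a * (1 - cos \<theta>))) \<le> integral {0..pi} (\<lambda>\<theta>. inverse (1 + b * \<theta>\<^sup>2))"
  proof (rule integral_le)
    fix \<theta> assume t: "\<theta> \<in> {0..pi}"
    have p: "0 < 1 + b * \<theta>\<^sup>2" using b by (intro add_pos_nonneg) auto
    have "1 + b * \<theta>\<^sup>2 \<le> exp (b * \<theta>\<^sup>2)" by (rule exp_ge_add_one_self)
    also have "b * \<theta>\<^sup>2 \<le> a * (1 - cos \<theta>)"
      using mult_left_mono[OF one_minus_cos_ge[of \<theta>], of a] t assms by (simp add: b_def)
    finally have "1 + b * \<theta>\<^sup>2 \<le> exp (a * (1 - cos \<theta>))" by simp
    from le_imp_inverse_le[OF this p]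
    show "exp (- a * (1 - cos \<theta>)) \<le> inverse (1 + b * \<theta>\<^sup>2)" by (simp add: exp_minus)
  next
    show "(\<lambda>\<theta>. exp (- a * (1 - cos \<theta>))) integrable_on {0..pi}"
      by (intro integrable_continuous_real continuous_intros)
    show "(\<lambda>\<theta>. inverse (1 + b * \<theta>\<^sup>2)) integrable_on {0..pi}"
      using int by (rule has_integral_integrable)
  qed
  also have "\<dots> = arctan (sqrt b * pi) / sqrt b" using int by (simp add: integral_unique)
  also have "\<dots> \<le> (pi / 2) / sqrt b"
    using b arctan_ubound[of "sqrt b * pi"] by (intro divide_right_mono) auto
  also have "sqrt b = sqrt a / (2 * sqrt 2)"
    by (simp add: b_def real_sqrt_divide real_sqrt_mult flip: real_sqrt_mult)
     (use real_sqrt_mult[of 4 2] in simp)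
  finally show ?thesis by simp
qed

lemma abs_integral_cos_le:
  fixes g h :: "real \<Rightarrow> real"
  assumes "continuous_on {0..pi} g" "continuous_on {0..pi} h"
    and le: "\<And>\<theta>. 0 \<le> \<theta> \<Longrightarrow> \<theta> \<le> pi \<Longrightarrow> \<bar>h \<theta>\<bar> \<le> g \<theta>"
  shows "\<bar>integral {0..pi} (\<lambda>\<theta>. h \<theta> * cos (a * \<theta>))\<bar> \<le> integral {0..pi} g"
proof -
  have "norm (integral {0..pi} (\<lambda>\<theta>. h \<theta> * cos (a * \<theta>))) \<le> integral {0..pi} g"
  proof (rule integral_norm_bound_integral)
    fix \<theta> assume "\<theta> \<in> {0..pi}"
    hence "\<bar>h \<theta>\<bar> * \<bar>cos (a * \<theta>)\<bar> \<le> g \<theta> * 1"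
      using le[of \<theta>] by (intro mult_mono) auto
    thus "norm (h \<theta> * cos (a * \<theta>)) \<le> g \<theta>" by (simp add: abs_mult)
  qed (intro integrable_continuous_real continuous_intros assms)+
  thus ?thesis by simp
qed

lemma x_exp_minus_le: "x * exp (- x) \<le> exp (- x / 2)" for x :: real
proof -
  have "x \<le> exp (x / 2)"
  proof (cases "x \<le> 0")
    case False
    have "0 \<le> (1 - x / 4)\<^sup>2" by simp
    hence "x \<le> (1 + x / 4)\<^sup>2" by (simp add: power2_eq_square algebra_simps)
    also have "\<dots> \<le> (exp (x / 4))\<^sup>2" using False by (intro power_mono) auto
    also have "\<dots> = exp (x / 2)" by (simp flip: exp_double)
    finally show ?thesis .
  qed (meson exp_ge_zero order_trans)
  hence "x * exp (- x) \<le> exp (x / 2) * exp (- x)" by (intro mult_right_mono) auto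
  thus ?thesis by (simp flip: exp_add)
qed

lemma x2_exp_minus_le:
  assumes "0 \<le> (x::real)" shows "x\<^sup>2 * exp (- x) \<le> 16 * exp (- x / 2)"
proof -
  have "x / 4 \<le> exp (x / 4)" using exp_ge_add_one_self[of "x / 4"] by linarith
  hence "(x / 4)\<^sup>2 \<le> (exp (x / 4))\<^sup>2" using assms by (intro power_mono) auto
  also have "\<dots> = exp (x / 2)" by (simp flip: exp_double)
  finally have "x\<^sup>2 * exp (- x) \<le> 16 * exp (x / 2) * exp (- x)"
    by (intro mult_right_mono) (auto simp: power_divide)
  thus ?thesis by (simp add: mult.assoc flip: exp_add)
qed

lemma walk_abs_le_1:
  assumes "0 \<le> r" shows "\<bar>walk n r\<bar> \<le> 1"
proof -
  have "\<bar>integral {0..pi} (\<lambda>\<theta>. exp (- r * (1 - cos \<theta>)) * cos (of_int n * \<theta>))\<bar> \<le>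
      integral {0..pi} (\<lambda>\<theta>. 1)"
    using assms by (intro abs_integral_cos_le continuous_intros) auto
  thus ?thesis using assms by (simp add: walk_integral)
qed

lemma walk_height:
  assumes "0 < r" shows "\<bar>walk n r\<bar> \<le> 2 / sqrt r"
proof -
  have "\<bar>integral {0..pi} (\<lambda>\<theta>. exp (- r * (1 - cos \<theta>)) * cos (of_int n * \<theta>))\<bar> \<le>
      integral {0..pi} (\<lambda>\<theta>. exp (- r * (1 - cos \<theta>)))"
    by (intro abs_integral_cos_le continuous_intros) auto
  also have "\<dots> \<le> pi * sqrt 2 / sqrt r" by (rule integral_exp_one_minus_cos[OF assms])
  finally have "\<bar>walk n r\<bar> \<le> sqrt 2 / sqrt r"
    using assms by (simp add: walk_integral field_simps)
  also have "sqrt 2 \<le> (2::real)" using sqrt_le_D by (intro real_le_lsqrt) auto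
  finally show ?thesis using assms by (simp add: divide_right_mono)
qed

lemma walk_lap_height:
  assumes "0 < r" shows "r * \<bar>walk_lap n r\<bar> \<le> 4 / sqrt r"
proof -
  have "\<bar>integral {0..pi} (\<lambda>\<theta>. (1 - cos \<theta>) * exp (- r * (1 - cos \<theta>)) * cos (of_int n * \<theta>))\<bar> \<le>
      integral {0..pi} (\<lambda>\<theta>. exp (- (r / 2) * (1 - cos \<theta>)) / r)"
  proof (intro abs_integral_cos_le continuous_intros)
    fix \<theta> :: real
    have "r * (1 - cos \<theta>) * exp (- r * (1 - cos \<theta>)) \<le> exp (- (r / 2) * (1 - cos \<theta>))"
      using x_exp_minus_le[of "r * (1 - cos \<theta>)"] by simp
    thus "\<bar>(1 - cos \<theta>) * exp (- r * (1 - cos \<theta>))\<bar> \<le> exp (- (r / 2) * (1 - cos \<theta>)) / r"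
      using assms by (simp add: abs_mult field_simps)
  qed (use assms in auto)
  also have "\<dots> \<le> pi * sqrt 2 / sqrt (r / 2) / r"
    unfolding integral_divide
    using integral_exp_one_minus_cos[of "r / 2"] assms by (intro divide_right_mono) auto
  also have "\<dots> = pi * 2 / sqrt r / r" by (simp add: real_sqrt_divide)
  finally show ?thesis
    using assms by (simp add: walk_lap_integral abs_mult field_simps)
qed

text \<open>
  Three integrations by parts, written as one antiderivative \<open>G\<close>. Its boundary values vanish because
  \<open>sin\<close> vanishes at multiples of \<open>\<pi>\<close> and \<open>h'\<close> vanishes at both ends.
\<close>
lemma cos_moment_cubed:
  fixes h h1 h2 h3 :: "real \<Rightarrow> real" and n :: int
  assumes h: "\<And>\<theta>. (h has_real_derivative h1 \<theta>) (at \<theta>)"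
    and h1: "\<And>\<theta>. (h1 has_real_derivative h2 \<theta>) (at \<theta>)"
    and h2: "\<And>\<theta>. (h2 has_real_derivative h3 \<theta>) (at \<theta>)"
    and "continuous_on {0..pi} h3" and "h1 0 = 0" "h1 pi = 0"
  shows "of_int n ^ 3 * integral {0..pi} (\<lambda>\<theta>. h \<theta> * cos (of_int n * \<theta>)) =
    integral {0..pi} (\<lambda>\<theta>. h3 \<theta> * sin (of_int n * \<theta>))"
proof -
  define k :: real where "k = of_int n"
  define G where "G \<theta> = k\<^sup>2 * (h \<theta> * sin (k * \<theta>)) + k * (h1 \<theta> * cos (k * \<theta>)) - h2 \<theta> * sin (k * \<theta>)" for \<theta>
  have "((\<lambda>\<theta>. k ^ 3 * (h \<theta> * cos (k * \<theta>)) - h3 \<theta> * sin (k * \<theta>)) has_integral G pi - G 0) {0..pi}"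
  proof (rule fundamental_theorem_of_calculus)
    fix \<theta> :: real
    have "(G has_real_derivative k ^ 3 * (h \<theta> * cos (k * \<theta>)) - h3 \<theta> * sin (k * \<theta>)) (at \<theta>)"
      unfolding G_def
      by (rule DERIV_cong, (rule derivative_intros h h1 h2)+)
        (simp add: algebra_simps power2_eq_square power3_eq_cube)
    thus "(G has_vector_derivative k ^ 3 * (h \<theta> * cos (k * \<theta>)) - h3 \<theta> * sin (k * \<theta>))
        (at \<theta> within {0..pi})"
      by (simp add: has_real_derivative_iff_has_vector_derivative has_vector_derivative_at_within)
  qed simp
  moreover have "sin (k * pi) = 0"
    using sin_times_pi_eq_0[of k] by (auto simp: k_def)
  hence "G pi - G 0 = 0" using assms by (simp add: G_def)
  ultimately have "integral {0..pi} (\<lambda>\<theta>. k ^ 3 * (h \<theta> * cos (k * \<theta>)) - h3 \<theta> * sin (k * \<theta>)) = 0"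
    by (simp add: integral_unique)
  moreover have "continuous_on {0..pi} h"
    using h by (meson DERIV_isCont continuous_at_imp_continuous_on)
  hence "integral {0..pi} (\<lambda>\<theta>. k ^ 3 * (h \<theta> * cos (k * \<theta>)) - h3 \<theta> * sin (k * \<theta>)) =
      integral {0..pi} (\<lambda>\<theta>. k ^ 3 * (h \<theta> * cos (k * \<theta>))) - integral {0..pi} (\<lambda>\<theta>. h3 \<theta> * sin (k * \<theta>))"
    using assms(4) by (intro integral_diff integrable_continuous_real continuous_intros)
  ultimately show ?thesis by (simp add: k_def)
qed

text \<open>
  The factor \<open>sin \<theta>\<close> in the third derivative is the Jacobian of \<open>u = 1 - cos \<theta>\<close>, so the dominating
  function has an elementary antiderivative, and its integral is bounded independently of \<open>r\<close>.
\<close>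
lemma cos_moment_cubed_bound:
  fixes h h1 h2 h3 :: "real \<Rightarrow> real" and n :: int
  assumes "\<And>\<theta>. (h has_real_derivative h1 \<theta>) (at \<theta>)"
    and "\<And>\<theta>. (h1 has_real_derivative h2 \<theta>) (at \<theta>)"
    and "\<And>\<theta>. (h2 has_real_derivative h3 \<theta>) (at \<theta>)"
    and cont: "continuous_on {0..pi} h3" and "h1 0 = 0" "h1 pi = 0"
    and le: "\<And>\<theta>. 0 \<le> \<theta> \<Longrightarrow> \<theta> \<le> pi \<Longrightarrow>
      \<bar>h3 \<theta>\<bar> \<le> sin \<theta> * (M * r * exp (- r * (1 - cos \<theta>) / 2) + N)"
    and "0 \<le> M"
  shows "\<bar>of_int n\<bar> ^ 3 * \<bar>integral {0..pi} (\<lambda>\<theta>. h \<theta> * cos (of_int n * \<theta>))\<bar> \<le> 2 * M + 2 * N"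
proof -
  let ?g = "\<lambda>\<theta>. sin \<theta> * (M * r * exp (- r * (1 - cos \<theta>) / 2) + N)"
  let ?G = "\<lambda>\<theta>. - 2 * M * exp (- r * (1 - cos \<theta>) / 2) + N * (1 - cos \<theta>)"
  have int: "(?g has_integral ?G pi - ?G 0) {0..pi}"
  proof (rule fundamental_theorem_of_calculus)
    fix \<theta> :: real
    have "(?G has_real_derivative ?g \<theta>) (at \<theta>)"
      by (auto intro!: derivative_eq_intros simp: algebra_simps)
    thus "(?G has_vector_derivative ?g \<theta>) (at \<theta> within {0..pi})"
      by (simp add: has_real_derivative_iff_has_vector_derivative has_vector_derivative_at_within)
  qed simp
  have "norm (integral {0..pi} (\<lambda>\<theta>. h3 \<theta> * sin (of_int n * \<theta>))) \<le> integral {0..pi} ?g"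
  proof (rule integral_norm_bound_integral)
    fix \<theta> assume t: "\<theta> \<in> {0..pi}"
    have "\<bar>h3 \<theta>\<bar> * \<bar>sin (of_int n * \<theta>)\<bar> \<le> \<bar>h3 \<theta>\<bar> * 1" by (intro mult_left_mono) auto
    thus "norm (h3 \<theta> * sin (of_int n * \<theta>)) \<le> ?g \<theta>" using le[of \<theta>] t by (simp add: abs_mult)
  qed (use cont int in \<open>auto intro!: integrable_continuous_real continuous_intros\<close>)
  also have "integral {0..pi} ?g = ?G pi - ?G 0" using int by (rule integral_unique)
  also have "\<dots> \<le> 2 * M + 2 * N" using \<open>0 \<le> M\<close> by simp
  finally have "\<bar>of_int n ^ 3 * integral {0..pi} (\<lambda>\<theta>. h \<theta> * cos (of_int n * \<theta>))\<bar> \<le> 2 * M + 2 * N"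
    using cos_moment_cubed[OF assms(1-6), of n] by simp
  thus ?thesis by (simp add: abs_mult power_abs)
qed

lemma sin_squared_le: "(sin \<theta>)\<^sup>2 \<le> 2 * (1 - cos \<theta>)" for \<theta> :: real
proof -
  have "(sin \<theta>)\<^sup>2 = (1 + cos \<theta>) * (1 - cos \<theta>)"
    by (simp add: sin_squared_eq power2_eq_square algebra_simps)
  also have "\<dots> \<le> 2 * (1 - cos \<theta>)" by (intro mult_right_mono) auto
  finally show ?thesis .
qed

text \<open>
  With \<open>u = 1 - cos \<theta>\<close>, every term of the third derivative of \<open>exp (- r u)\<close> carries a factor \<open>sin \<theta>\<close>,
  and \<open>(sin \<theta>)\<^sup>2 \<le> 2 u\<close> turns surplus powers of \<open>r\<close> into powers of \<open>r u\<close>, which the exponential absorbs.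
\<close>
lemma walk_tail:
  assumes "0 < r" shows "\<bar>of_int n\<bar> ^ 3 * \<bar>walk n r\<bar> \<le> 12 * r"
proof -
  let ?f = "\<lambda>\<theta>. exp (- r * (1 - cos \<theta>))"
  let ?h1 = "\<lambda>\<theta>. - r * sin \<theta> * ?f \<theta>"
  let ?h2 = "\<lambda>\<theta>. (r\<^sup>2 * (sin \<theta>)\<^sup>2 - r * cos \<theta>) * ?f \<theta>"
  let ?h3 = "\<lambda>\<theta>. sin \<theta> * ((3 * r\<^sup>2 * cos \<theta> + r - r ^ 3 * (sin \<theta>)\<^sup>2) * ?f \<theta>)"
  have "\<bar>of_int n\<bar> ^ 3 * \<bar>integral {0..pi} (\<lambda>\<theta>. ?f \<theta> * cos (of_int n * \<theta>))\<bar> \<le> 2 * (5 * r) + 2 * r"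
  proof (rule cos_moment_cubed_bound)
    fix \<theta> :: real
    show "(?f has_real_derivative ?h1 \<theta>) (at \<theta>)"
      by (auto intro!: derivative_eq_intros)
    show "(?h1 has_real_derivative ?h2 \<theta>) (at \<theta>)"
      by (auto intro!: derivative_eq_intros simp: algebra_simps power2_eq_square)
    show "(?h2 has_real_derivative ?h3 \<theta>) (at \<theta>)"
      by (rule DERIV_cong, (rule derivative_intros refl)+)
        (simp add: algebra_simps power2_eq_square power3_eq_cube)
    assume t: "0 \<le> \<theta>" "\<theta> \<le> pi"
    define y where "y = r * (1 - cos \<theta>)"
    have y: "0 \<le> y" using assms by (simp add: y_def)
    have f: "?f \<theta> = exp (- y)" "exp (- r * (1 - cos \<theta>) / 2) = exp (- y / 2)" by (simp_all add: y_def)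
    have c: "\<bar>3 * r\<^sup>2 * cos \<theta>\<bar> \<le> 3 * r\<^sup>2"
      using mult_left_mono[of "\<bar>cos \<theta>\<bar>" 1 "3 * r\<^sup>2"] by (simp add: abs_mult)
    have s: "\<bar>r ^ 3 * (sin \<theta>)\<^sup>2\<bar> \<le> 2 * r\<^sup>2 * y"
      using mult_left_mono[OF sin_squared_le[of \<theta>], of "r ^ 3"] assms
      by (simp add: abs_mult y_def power2_eq_square power3_eq_cube mult_ac)
    have e: "exp (- y) \<le> exp (- y / 2)" "exp (- y) \<le> 1" "y * exp (- y) \<le> exp (- y / 2)"
      using y x_exp_minus_le[of y] by auto
    have "\<bar>3 * r\<^sup>2 * cos \<theta> + r - r ^ 3 * (sin \<theta>)\<^sup>2\<bar> \<le> 3 * r\<^sup>2 + r + 2 * r\<^sup>2 * y"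
      using c s assms by linarith
    hence "\<bar>(3 * r\<^sup>2 * cos \<theta> + r - r ^ 3 * (sin \<theta>)\<^sup>2) * ?f \<theta>\<bar> \<le>
        (3 * r\<^sup>2 + r + 2 * r\<^sup>2 * y) * exp (- y)"
      unfolding f by (simp add: abs_mult mult_right_mono)
    also have "\<dots> = 3 * r\<^sup>2 * exp (- y) + r * exp (- y) + 2 * r\<^sup>2 * (y * exp (- y))"
      by (simp add: algebra_simps)
    also have "\<dots> \<le> 3 * r\<^sup>2 * exp (- y / 2) + r * 1 + 2 * r\<^sup>2 * exp (- y / 2)"
      using e assms by (intro add_mono mult_left_mono) auto
    also have "\<dots> = 5 * r * r * exp (- y / 2) + r" by (simp add: power2_eq_square)
    finally show "\<bar>?h3 \<theta>\<bar> \<le> sin \<theta> * (5 * r * r * exp (- r * (1 - cos \<theta>) / 2) + r)"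
      unfolding f(2) abs_mult[of "sin \<theta>"] using sin_ge_zero[OF t] by (simp add: mult_left_mono)
  qed (use assms in \<open>auto intro!: continuous_intros\<close>)
  also have "2 * (5 * r) + 2 * r \<le> 12 * r * pi" using assms pi_gt3 by simp
  finally show ?thesis
    using assms by (simp add: walk_integral field_simps)
qed

text \<open>
  The second difference multiplies the integrand by \<open>- 2 u\<close>, where \<open>u = 1 - cos \<theta>\<close>; as \<open>u\<close> is of order
  \<open>1 / r\<close> on the bulk of the integral, this gains a factor \<open>1 / r\<close> over \<open>walk_tail\<close>.
\<close>
lemma walk_lap_tail:
  assumes "0 < r" shows "\<bar>of_int n\<bar> ^ 3 * \<bar>walk_lap n r\<bar> \<le> 96"
proof -
  let ?f = "\<lambda>\<theta>. exp (- r * (1 - cos \<theta>))"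
  let ?h = "\<lambda>\<theta>. (1 - cos \<theta>) * ?f \<theta>"
  let ?h1 = "\<lambda>\<theta>. sin \<theta> * (1 - r * (1 - cos \<theta>)) * ?f \<theta>"
  let ?h2 = "\<lambda>\<theta>. (cos \<theta> * (1 - r * (1 - cos \<theta>)) - r * (sin \<theta>)\<^sup>2 * (2 - r * (1 - cos \<theta>))) * ?f \<theta>"
  let ?h3 = "\<lambda>\<theta>. sin \<theta> * ((r * (1 - cos \<theta>) - 1 - r * cos \<theta> * (6 - 3 * (r * (1 - cos \<theta>))) +
      r\<^sup>2 * (sin \<theta>)\<^sup>2 * (3 - r * (1 - cos \<theta>))) * ?f \<theta>)"
  have "\<bar>of_int n\<bar> ^ 3 * \<bar>integral {0..pi} (\<lambda>\<theta>. ?h \<theta> * cos (of_int n * \<theta>))\<bar> \<le> 2 * 47 + 2 * 1"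
  proof (rule cos_moment_cubed_bound)
    fix \<theta> :: real
    show "(?h has_real_derivative ?h1 \<theta>) (at \<theta>)"
      by (auto intro!: derivative_eq_intros simp: algebra_simps)
    show "(?h1 has_real_derivative ?h2 \<theta>) (at \<theta>)"
      by (rule DERIV_cong, (rule derivative_intros refl)+)
        (simp add: algebra_simps power2_eq_square power3_eq_cube)
    show "(?h2 has_real_derivative ?h3 \<theta>) (at \<theta>)"
      by (rule DERIV_cong, (rule derivative_intros refl)+)
        (simp add: algebra_simps power2_eq_square power3_eq_cube)
    assume t: "0 \<le> \<theta>" "\<theta> \<le> pi"
    define y where "y = r * (1 - cos \<theta>)"
    have y: "0 \<le> y" using assms by (simp add: y_def)
    have f: "?f \<theta> = exp (- y)" "exp (- r * (1 - cos \<theta>) / 2) = exp (- y / 2)" by (simp_all add: y_def)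
    have "\<bar>r * cos \<theta>\<bar> \<le> r"
      using mult_left_mono[of "\<bar>cos \<theta>\<bar>" 1 "r"] assms by (simp add: abs_mult)
    hence c: "\<bar>r * cos \<theta> * (6 - 3 * y)\<bar> \<le> r * (6 + 3 * y)"
      unfolding abs_mult[of "r * cos \<theta>"] using y assms by (intro mult_mono) auto
    have "\<bar>r\<^sup>2 * (sin \<theta>)\<^sup>2\<bar> \<le> 2 * r * y"
      using mult_left_mono[OF sin_squared_le[of \<theta>], of "r ^ 2"] assms
      by (simp add: abs_mult y_def power2_eq_square power3_eq_cube mult_ac)
    hence s: "\<bar>r\<^sup>2 * (sin \<theta>)\<^sup>2 * (3 - y)\<bar> \<le> 2 * r * y * (3 + y)"
      unfolding abs_mult[of "r\<^sup>2 * (sin \<theta>)\<^sup>2"] using y assms by (intro mult_mono) auto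
    have e: "exp (- y) \<le> exp (- y / 2)" "y * exp (- y) \<le> exp (- y / 2)"
        "y\<^sup>2 * exp (- y) \<le> 16 * exp (- y / 2)"
      using y x_exp_minus_le[of y] x2_exp_minus_le[of y] by auto
    have e1: "(1 + y) * exp (- y) \<le> 1"
      using mult_right_mono[OF exp_ge_add_one_self[of y], of "exp (- y)"] by (simp flip: exp_add)
    have "\<bar>y - 1 - r * cos \<theta> * (6 - 3 * y) + r\<^sup>2 * (sin \<theta>)\<^sup>2 * (3 - y)\<bar> \<le>
        (1 + y) + r * (6 + 3 * y) + 2 * r * y * (3 + y)"
      using c s y by linarith
    hence "\<bar>(y - 1 - r * cos \<theta> * (6 - 3 * y) + r\<^sup>2 * (sin \<theta>)\<^sup>2 * (3 - y)) * ?f \<theta>\<bar> \<le>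
        ((1 + y) + r * (6 + 3 * y) + 2 * r * y * (3 + y)) * exp (- y)"
      unfolding f by (simp add: abs_mult mult_right_mono)
    also have "\<dots> = (1 + y) * exp (- y) + r * (6 * exp (- y) + 9 * (y * exp (- y)) + 2 * (y\<^sup>2 * exp (- y)))"
      by (simp add: algebra_simps power2_eq_square)
    also have "\<dots> \<le> 1 + r * (6 * exp (- y / 2) + 9 * exp (- y / 2) + 2 * (16 * exp (- y / 2)))"
      using e e1 assms by (intro add_mono mult_left_mono) auto
    also have "\<dots> = 47 * r * exp (- y / 2) + 1" by simp
    finally show "\<bar>?h3 \<theta>\<bar> \<le> sin \<theta> * (47 * r * exp (- r * (1 - cos \<theta>) / 2) + 1)"
      unfolding f(2) abs_mult[of "sin \<theta>"] y_def using sin_ge_zero[OF t] by (simp add: mult_left_mono)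
  qed (use assms in \<open>auto intro!: continuous_intros\<close>)
  also have "2 * 47 + 2 * 1 \<le> 96 * pi / 2" using pi_gt3 by simp
  finally show ?thesis
    using assms by (simp add: walk_lap_integral abs_mult field_simps)
qed

section \<open>The profile and its domination of the random walk kernel\<close>

text \<open>
  For \<open>s \<ge> 1\<close> this is the Poisson kernel \<open>s / (s\<^sup>2 + n\<^sup>2)\<close>. For small \<open>s\<close> the Poisson
  kernel would blow up at \<open>n = 0\<close>; there the value \<open>1\<close> is used, since a diffusion of scale \<open>s < 1\<close>
  keeps a mass of order \<open>1\<close> at its starting point.
\<close>
definition profile :: "real \<Rightarrow> int \<Rightarrow> real" where
  "profile s n = (if n = 0 then 1 / max 1 s else s / (s\<^sup>2 + (of_int n)\<^sup>2))"

lemma profile_nonneg: "0 < s \<Longrightarrow> 0 \<le> profile s n"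
  by (simp add: profile_def max_def)

lemma profile_minus: "profile s (- n) = profile s n"
  by (simp add: profile_def)

lemma of_int_square_ge_1: "n \<noteq> 0 \<Longrightarrow> 1 \<le> (of_int n :: real)\<^sup>2"
proof -
  assume "n \<noteq> 0"
  hence "1 \<le> \<bar>n\<bar>" by linarith
  hence "1 \<le> \<bar>of_int n :: real\<bar>" by linarith
  hence "1\<^sup>2 \<le> \<bar>of_int n :: real\<bar>\<^sup>2" by (intro power_mono) auto
  thus ?thesis by simp
qed

lemma profile_le_height:
  assumes "0 < s" shows "profile s n \<le> 1 / max 1 s"
proof (cases "n = 0")
  case False
  have "s \<le> s\<^sup>2 + 1"
  proof -
    have "0 \<le> (s - 1)\<^sup>2" by simp
    hence "2 * s \<le> s\<^sup>2 + 1" by (simp add: power2_eq_square algebra_simps)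
    thus ?thesis using assms by simp
  qed
  hence "s * max 1 s \<le> s\<^sup>2 + (of_int n)\<^sup>2"
    using of_int_square_ge_1[OF False] by (auto simp: max_def power2_eq_square)
  moreover have "0 < s\<^sup>2 + (of_int n)\<^sup>2" using assms by (intro add_pos_nonneg) auto
  moreover have "0 < max 1 s" by simp
  ultimately have "s / (s\<^sup>2 + (of_int n)\<^sup>2) \<le> 1 / max 1 s" by (simp only: divide_simps) simp
  thus ?thesis using False by (simp add: profile_def)
qed (simp add: profile_def)

lemma profile_le_tail:
  assumes "0 < s" "n \<noteq> 0" shows "profile s n \<le> s / (of_int n)\<^sup>2"
  using assms by (simp add: profile_def frac_le)

lemma le_profileI:
  assumes "0 < s" "0 \<le> C"
    and "n = 0 \<Longrightarrow> y \<le> C" "n = 0 \<Longrightarrow> s * y \<le> C"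
    and "n \<noteq> 0 \<Longrightarrow> s\<^sup>2 * y + (of_int n)\<^sup>2 * y \<le> C * s"
  shows "y \<le> C * profile s n"
proof (cases "n = 0")
  case False
  have "0 < s\<^sup>2 + (of_int n)\<^sup>2" using assms(1) by (intro add_pos_nonneg) auto
  thus ?thesis using assms(5) False by (simp add: profile_def pos_le_divide_eq algebra_simps)
qed (use assms in \<open>auto simp: profile_def max_def pos_le_divide_eq mult.commute\<close>)

text \<open>
  These let the height \<open>x\<^sup>3 y \<le> C\<close> and the cubic moment \<open>m\<^sup>3 y \<le> C'\<close> of a quantity \<open>y\<close> control its
  first and second moments.
\<close>
lemma interpolate_cubes:
  assumes "0 \<le> x" "0 \<le> (m::real)"
  shows "m\<^sup>2 * x \<le> x ^ 3 + m ^ 3" "m * x\<^sup>2 \<le> x ^ 3 + m ^ 3"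
proof -
  have *: "a * b\<^sup>2 \<le> a ^ 3 + b ^ 3" if "0 \<le> a" "0 \<le> b" for a b :: real
  proof (cases "a \<le> b")
    case True
    hence "a * b\<^sup>2 \<le> b * b\<^sup>2" by (intro mult_right_mono) auto
    moreover have "0 \<le> a ^ 3" using that by simp
    ultimately show ?thesis by (simp add: power2_eq_square power3_eq_cube)
  next
    case False
    hence "a * b\<^sup>2 \<le> a * a\<^sup>2" using that by (intro mult_left_mono power_mono) auto
    moreover have "0 \<le> b ^ 3" using that by simp
    ultimately show ?thesis by (simp add: power2_eq_square power3_eq_cube)
  qed
  from *[of x m] *[of m x] assms show "m\<^sup>2 * x \<le> x ^ 3 + m ^ 3" "m * x\<^sup>2 \<le> x ^ 3 + m ^ 3"
    by (simp_all add: mult.commute add.commute)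
qed

definition walk_const :: "real \<Rightarrow> real" where "walk_const v = 200 / v ^ 3"

text \<open>
  In the application \<open>x\<^sup>2\<close> is the time \<open>2 c_\<beta> t / dx\<^sup>2\<close> of the walk with the frozen coefficient, whereas
  \<open>s\<^sup>2\<close> is built from the supremum of all coefficients. Their ratio \<open>x\<^sup>2 / s\<^sup>2\<close> lies between \<open>lo / hi\<close>
  and \<open>1\<close>, and \<open>v\<^sup>2 = lo / hi\<close>.
\<close>
locale comparable_scales =
  fixes v s x :: real
  assumes v: "0 < v" "v \<le> 1" and s: "0 < s" and vs: "v * s \<le> x" and xs: "x \<le> s"
begin

lemma x_pos: "0 < x"
  using v s vs by (meson less_le_trans mult_pos_pos)

lemma s_le: "s \<le> x / v"
  using v vs by (simp add: pos_le_divide_eq mult.commute)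

lemma walk_weighted:
  "x * \<bar>walk n (x\<^sup>2)\<bar> \<le> 2"
  "\<bar>of_int n\<bar> ^ 3 * \<bar>walk n (x\<^sup>2)\<bar> \<le> 12 * x\<^sup>2"
  "(of_int n)\<^sup>2 * \<bar>walk n (x\<^sup>2)\<bar> \<le> 14 * x"
  "\<bar>of_int n\<bar> * \<bar>walk n (x\<^sup>2)\<bar> \<le> 14"
proof -
  note x = x_pos
  let ?q = "\<bar>walk n (x\<^sup>2)\<bar>" and ?m = "\<bar>of_int n :: real\<bar>"
  show 1: "x * ?q \<le> 2"
    using walk_height[of "x\<^sup>2" n] x by (simp add: field_simps)
  show 2: "?m ^ 3 * ?q \<le> 12 * x\<^sup>2"
    using walk_tail[of "x\<^sup>2" n] x by simp
  have 3: "x ^ 3 * ?q + ?m ^ 3 * ?q \<le> 14 * x\<^sup>2"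
    using mult_left_mono[OF 1, of "x\<^sup>2"] 2 by (simp add: power2_eq_square power3_eq_cube mult_ac)
  have "?m\<^sup>2 * x * ?q \<le> (x ^ 3 + ?m ^ 3) * ?q" "?m * x\<^sup>2 * ?q \<le> (x ^ 3 + ?m ^ 3) * ?q"
    using x by (intro mult_right_mono interpolate_cubes; simp)+
  hence "x * (?m\<^sup>2 * ?q) \<le> x * (14 * x)" "x\<^sup>2 * (?m * ?q) \<le> x\<^sup>2 * 14"
    using 3 by (simp_all add: algebra_simps power2_eq_square power3_eq_cube)
  thus "(of_int n)\<^sup>2 * ?q \<le> 14 * x" "?m * ?q \<le> 14"
    using x by simp_all
qed

lemma walk_lap_weighted:
  "\<bar>walk_lap n (x\<^sup>2)\<bar> \<le> 4"
  "x ^ 3 * \<bar>walk_lap n (x\<^sup>2)\<bar> \<le> 4"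
  "\<bar>of_int n\<bar> ^ 3 * \<bar>walk_lap n (x\<^sup>2)\<bar> \<le> 96"
  "x * (of_int n)\<^sup>2 * \<bar>walk_lap n (x\<^sup>2)\<bar> \<le> 100"
  "x\<^sup>2 * \<bar>of_int n\<bar> * \<bar>walk_lap n (x\<^sup>2)\<bar> \<le> 100"
proof -
  note x = x_pos
  let ?q = "\<bar>walk_lap n (x\<^sup>2)\<bar>" and ?m = "\<bar>of_int n :: real\<bar>"
  show "?q \<le> 4"
    using walk_abs_le_1[of "x\<^sup>2" n] walk_abs_le_1[of "x\<^sup>2" "n + 1"] walk_abs_le_1[of "x\<^sup>2" "n - 1"]
    by (simp add: walk_lap_def)
  show 1: "x ^ 3 * ?q \<le> 4"
    using walk_lap_height[of "x\<^sup>2" n] x by (simp add: field_simps power2_eq_square power3_eq_cube)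
  show 2: "?m ^ 3 * ?q \<le> 96"
    using walk_lap_tail[of "x\<^sup>2" n] x by simp
  have "?m\<^sup>2 * x * ?q \<le> (x ^ 3 + ?m ^ 3) * ?q" "?m * x\<^sup>2 * ?q \<le> (x ^ 3 + ?m ^ 3) * ?q"
    using x by (intro mult_right_mono interpolate_cubes; simp)+
  thus "x * (of_int n)\<^sup>2 * ?q \<le> 100" "x\<^sup>2 * ?m * ?q \<le> 100"
    using 1 2 by (simp_all add: algebra_simps)
qed

abbreviation K :: real where "K \<equiv> walk_const v"

lemma K_ge: "200 \<le> K" "200 / v \<le> K" "200 / v\<^sup>2 \<le> K"
  using v by (auto simp: walk_const_def power2_eq_square power3_eq_cube field_simps mult_le_one
      intro: mult_le_one)

lemma walk_le_profile: "\<bar>walk n (x\<^sup>2)\<bar> \<le> K * profile s n"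
proof (rule le_profileI)
  let ?q = "\<bar>walk n (x\<^sup>2)\<bar>"
  show "?q \<le> K" using walk_abs_le_1[of "x\<^sup>2" n] K_ge by simp
  have sq: "s * ?q \<le> 2 / v"
    using mult_right_mono[OF s_le, of ?q] divide_right_mono[OF walk_weighted(1)[of n], of v] v by simp
  thus "s * ?q \<le> K" using K_ge v by (smt (verit) divide_right_mono)
  have "s\<^sup>2 * ?q + (of_int n)\<^sup>2 * ?q \<le> s * (2 / v) + 14 * s"
    using mult_left_mono[OF sq, of s] s walk_weighted(3)[of n] xs by (simp add: power2_eq_square)
  also have "\<dots> = (2 / v + 14) * s" by (simp add: algebra_simps)
  also have "2 / v + 14 \<le> 200 / v" using v by (simp add: field_simps)
  also have "\<dots> \<le> K" by (rule K_ge)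
  finally show "s\<^sup>2 * ?q + (of_int n)\<^sup>2 * ?q \<le> K * s" using s by simp
qed (use s K_ge in auto)

lemma index_walk_le_profile: "\<bar>of_int n\<bar> * \<bar>walk n (x\<^sup>2)\<bar> \<le> K * s * profile s n"
proof (rule le_profileI)
  let ?q = "\<bar>of_int n\<bar> * \<bar>walk n (x\<^sup>2)\<bar>"
  have "s\<^sup>2 * ?q + (of_int n)\<^sup>2 * ?q = s\<^sup>2 * ?q + \<bar>of_int n\<bar> ^ 3 * \<bar>walk n (x\<^sup>2)\<bar>"
    by (simp add: power3_eq_cube power2_eq_square)
  also have "\<dots> \<le> s\<^sup>2 * 14 + 12 * s\<^sup>2"
  proof (intro add_mono mult_left_mono)
    have "x\<^sup>2 \<le> s\<^sup>2" using xs x_pos by (intro power_mono) auto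
    thus "\<bar>of_int n\<bar> ^ 3 * \<bar>walk n (x\<^sup>2)\<bar> \<le> 12 * s\<^sup>2" using walk_weighted(2)[of n] by linarith
  qed (use walk_weighted(4) in auto)
  also have "\<dots> \<le> 200 * (s * s)" by (simp add: power2_eq_square)
  also have "\<dots> \<le> K * (s * s)" using K_ge(1) by (intro mult_right_mono) auto
  also have "\<dots> = K * s * s" by simp
  finally show "s\<^sup>2 * ?q + (of_int n)\<^sup>2 * ?q \<le> K * s * s" .
qed (use s K_ge in auto)

lemma walk_lap_le_profile: "s\<^sup>2 * \<bar>walk_lap n (x\<^sup>2)\<bar> \<le> K * profile s n"
proof (rule le_profileI)
  let ?q = "\<bar>walk_lap n (x\<^sup>2)\<bar>"
  have "s ^ 3 \<le> (x / v) ^ 3" using s s_le by (intro power_mono) auto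
  hence "s ^ 3 * ?q \<le> (x / v) ^ 3 * ?q" by (rule mult_right_mono) auto
  also have "\<dots> = (x ^ 3 * ?q) / v ^ 3" by (simp add: power_divide)
  also have "\<dots> \<le> 4 / v ^ 3" using walk_lap_weighted(2) v by (intro divide_right_mono) auto
  finally have s3: "s ^ 3 * ?q \<le> 4 / v ^ 3" .
  have K4: "4 / v ^ 3 \<le> K" using v by (simp add: walk_const_def divide_right_mono)
  show "s * (s\<^sup>2 * ?q) \<le> K" using s3 K4 by (simp add: power2_eq_square power3_eq_cube mult_ac)
  show "s\<^sup>2 * ?q \<le> K"
  proof (cases "s \<le> 1")
    case True
    hence "s\<^sup>2 * ?q \<le> 1 * 4"
      using s walk_lap_weighted(1)[of n] by (intro mult_mono) (auto simp: power_le_one)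
    thus ?thesis using K_ge by simp
  next
    case False
    hence "s\<^sup>2 * ?q \<le> s ^ 3 * ?q" by (intro mult_right_mono power_increasing) auto
    thus ?thesis using s3 K4 by simp
  qed
  have "s * ((of_int n)\<^sup>2 * ?q) \<le> (x / v) * ((of_int n)\<^sup>2 * ?q)"
    using s_le by (rule mult_right_mono) auto
  also have "\<dots> \<le> 100 / v"
    using divide_right_mono[OF walk_lap_weighted(4)[of n], of v] v by (simp add: mult_ac)
  also have "\<dots> \<le> K / 2" using K_ge(2) by simp
  finally have n2: "s * ((of_int n)\<^sup>2 * ?q) \<le> K / 2" .
  have "s\<^sup>2 * (s\<^sup>2 * ?q) + (of_int n)\<^sup>2 * (s\<^sup>2 * ?q) = (s ^ 3 * ?q + s * ((of_int n)\<^sup>2 * ?q)) * s"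
    by (simp add: algebra_simps power2_eq_square power3_eq_cube)
  also have "\<dots> \<le> (4 / v ^ 3 + K / 2) * s"
    using s3 n2 s by (intro mult_right_mono add_mono) auto
  also have "4 / v ^ 3 + K / 2 \<le> K" using v by (simp add: walk_const_def field_simps)
  finally show "s\<^sup>2 * (s\<^sup>2 * ?q) + (of_int n)\<^sup>2 * (s\<^sup>2 * ?q) \<le> K * s" using s by simp
qed (use s K_ge in auto)

lemma index_walk_lap_le_profile: "s * (\<bar>of_int n\<bar> * \<bar>walk_lap n (x\<^sup>2)\<bar>) \<le> K * profile s n"
proof (rule le_profileI)
  let ?q = "\<bar>walk_lap n (x\<^sup>2)\<bar>" and ?m = "\<bar>of_int n :: real\<bar>"
  have "s\<^sup>2 \<le> (x / v)\<^sup>2" using s s_le by (intro power_mono) auto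
  hence "s\<^sup>2 * (?m * ?q) \<le> (x / v)\<^sup>2 * (?m * ?q)" by (rule mult_right_mono) auto
  also have "\<dots> = (x\<^sup>2 * ?m * ?q) / v\<^sup>2" by (simp add: power_divide)
  also have "\<dots> \<le> 100 / v\<^sup>2" using walk_lap_weighted(5) v by (intro divide_right_mono) auto
  also have "\<dots> \<le> K / 2" using K_ge(3) by simp
  finally have s2: "s\<^sup>2 * (?m * ?q) \<le> K / 2" .
  have "s\<^sup>2 * (s * (?m * ?q)) + (of_int n)\<^sup>2 * (s * (?m * ?q)) = (s\<^sup>2 * (?m * ?q) + ?m ^ 3 * ?q) * s"
    by (simp add: algebra_simps power2_eq_square power3_eq_cube)
  also have "\<dots> \<le> (K / 2 + 96) * s"
    using s2 walk_lap_weighted(3)[of n] s by (intro mult_right_mono add_mono) auto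
  also have "\<dots> \<le> K * s" using K_ge s by (intro mult_right_mono) auto
  finally show "s\<^sup>2 * (s * (?m * ?q)) + (of_int n)\<^sup>2 * (s * (?m * ?q)) \<le> K * s" .
qed (use s K_ge in auto)

end

section \<open>Convolution of profiles\<close>

text \<open>
  Let \<open>\<rho> = sqrt (s\<^sup>2 + t\<^sup>2)\<close>. The larger of \<open>s\<close> and \<open>t\<close> is at least \<open>\<rho> / 2\<close>, so its profile has height
  at most \<open>2 / max 1 \<rho>\<close>: this settles \<open>\<bar>a + b\<bar> \<le> \<rho>\<close>. Further out, one of \<open>\<bar>a\<bar>\<close> and \<open>\<bar>b\<bar>\<close> is at least
  \<open>\<bar>a + b\<bar> / 2\<close>, and the tail of the corresponding profile decays quadratically. Multiplying out the
  definition of the profile at \<open>a + b\<close>, the two estimates are simply added.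
\<close>
lemma profile_min:
  assumes "0 < s" "0 < t"
  shows "min (profile s a) (profile t b) \<le> 8 * profile (sqrt (s\<^sup>2 + t\<^sup>2)) (a + b)"
proof -
  define \<rho> where "\<rho> = sqrt (s\<^sup>2 + t\<^sup>2)"
  have \<rho>2: "\<rho>\<^sup>2 = s\<^sup>2 + t\<^sup>2" by (simp add: \<rho>_def)
  have \<rho>: "0 < \<rho>" using assms by (simp add: \<rho>_def add_pos_pos)
  have le: "s \<le> \<rho>" "t \<le> \<rho>" unfolding \<rho>_def by (rule real_le_rsqrt; simp)+
  have max: "\<rho> \<le> 2 * max s t"
  proof -
    have "s\<^sup>2 \<le> (max s t)\<^sup>2" "t\<^sup>2 \<le> (max s t)\<^sup>2" using assms by (auto intro!: power_mono)
    moreover have "0 \<le> (max s t)\<^sup>2" by simp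
    ultimately have "\<rho>\<^sup>2 \<le> (2 * max s t)\<^sup>2"
      unfolding \<rho>2 power_mult_distrib power2_eq_square[of "2::real"] by linarith
    moreover have "0 \<le> 2 * max s t" using assms(1) by (simp add: le_max_iff_disj)
    ultimately show ?thesis by (rule power2_le_imp_le)
  qed
  have "min (profile s a) (profile t b) \<le> 1 / max 1 (max s t)"
    using profile_le_height[OF assms(1), of a] profile_le_height[OF assms(2), of b]
    by (auto simp: max_def min_def split: if_splits)
  also have "\<dots> \<le> 2 / max 1 \<rho>"
    using max by (auto simp: divide_simps max_def)
  finally have height: "min (profile s a) (profile t b) \<le> 2 / max 1 \<rho>" .
  define m where "m = min (profile s a) (profile t b)"
  have m0: "0 \<le> m" using assms by (simp add: m_def profile_nonneg)
  have "m \<le> 8 * profile \<rho> (a + b)"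
  proof (rule le_profileI[OF \<rho>])
    have "m * max 1 \<rho> \<le> 2" using height \<rho> by (simp add: m_def pos_le_divide_eq max_def)
    moreover have "m * 1 \<le> m * max 1 \<rho>" "m * \<rho> \<le> m * max 1 \<rho>"
      using m0 by (intro mult_left_mono; simp)+
    ultimately have m2: "m \<le> 2" and rm: "\<rho> * m \<le> 2" by (simp_all add: mult.commute)
    from m2 rm show "m \<le> 8" "\<rho> * m \<le> 8" by simp_all
    assume ab: "a + b \<noteq> 0"
    have tail: "(of_int (a + b))\<^sup>2 * m \<le> 4 * \<rho>"
    proof -
      \<comment> \<open>A point \<open>k\<close> at least half as far out as \<open>a + b\<close> lies in the quadratic tail.\<close>
      have far: "(of_int (a + b))\<^sup>2 * m \<le> 4 * \<rho>"
        if "\<bar>a + b\<bar> \<le> 2 * \<bar>k\<bar>" "m \<le> profile u k" "0 < u" "u \<le> \<rho>" for k u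
      proof -
        have k: "k \<noteq> 0" using that ab by auto
        have "\<bar>of_int (a + b) :: real\<bar> \<le> \<bar>2 * of_int k\<bar>" using that(1) by linarith
        hence sq: "(of_int (a + b))\<^sup>2 \<le> (2 * of_int k :: real)\<^sup>2" by (simp only: abs_le_square_iff)
        have "m \<le> u / (of_int k)\<^sup>2" using profile_le_tail[OF that(3) k] that(2) by simp
        hence mk: "(of_int k)\<^sup>2 * m \<le> u" using k by (simp add: field_simps)
        have "(of_int (a + b))\<^sup>2 * m \<le> (2 * of_int k)\<^sup>2 * m"
          using sq m0 by (rule mult_right_mono)
        thus ?thesis using mk that(4) by (simp add: power_mult_distrib)
      qed
      have "\<bar>a + b\<bar> \<le> 2 * \<bar>a\<bar> \<or> \<bar>a + b\<bar> \<le> 2 * \<bar>b\<bar>" by linarith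
      thus ?thesis using far[of a s] far[of b t] le assms by (auto simp: m_def)
    qed
    have "\<rho> * (\<rho> * m) \<le> \<rho> * 2" using rm \<rho> by (intro mult_left_mono) auto
    hence "\<rho>\<^sup>2 * m \<le> 2 * \<rho>" by (simp add: power2_eq_square)
    with tail \<rho> show "\<rho>\<^sup>2 * m + (of_int (a + b))\<^sup>2 * m \<le> 8 * \<rho>" by linarith
  qed simp
  thus ?thesis by (simp add: m_def \<rho>_def)
qed

lemma profile_mult_le:
  assumes "0 < s" "0 < t"
  shows "profile s a * profile t b \<le>
    8 * profile (sqrt (s\<^sup>2 + t\<^sup>2)) (a + b) * (profile s a + profile t b)"
proof -
  let ?p = "profile s a" and ?q = "profile t b"
  have "?p * ?q = min ?p ?q * max ?p ?q" by (simp add: min_def max_def)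
  also have "\<dots> \<le> (8 * profile (sqrt (s\<^sup>2 + t\<^sup>2)) (a + b)) * (?p + ?q)"
    using profile_nonneg[OF assms(1), of a] profile_nonneg[OF assms(2), of b]
      profile_nonneg[of "sqrt (s\<^sup>2 + t\<^sup>2)" "a + b"] assms
    by (intro mult_mono profile_min assms) (auto simp: add_pos_pos)
  finally show ?thesis .
qed

text \<open>
  Comparison with the integral of \<open>s / (s\<^sup>2 + y\<^sup>2)\<close>, whose antiderivative \<open>arctan (y / s)\<close> is bounded
  independently of \<open>s\<close>.
\<close>
lemma profile_sum_le:
  assumes s: "0 < s" and "finite F"
  shows "sum (profile s) F \<le> 1 + pi"
proof -
  have sym: "sum (profile s) {- int N..int N} \<le> 1 + 2 * arctan (real N / s)" for N
  proof (induction N)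
    case (Suc N)
    have step: "profile s (int (Suc N)) \<le> arctan (real (Suc N) / s) - arctan (real N / s)"
    proof -
      have "\<exists>z. real N / s < z \<and> z < real (Suc N) / s \<and>
          arctan (real (Suc N) / s) - arctan (real N / s) =
          (real (Suc N) / s - real N / s) * inverse (1 + z\<^sup>2)"
        using s by (intro MVT2 DERIV_arctan) (auto simp: divide_strict_right_mono)
      then obtain z where z: "real N / s < z" "z < real (Suc N) / s" and
        eq: "arctan (real (Suc N) / s) - arctan (real N / s) =
          (real (Suc N) / s - real N / s) * inverse (1 + z\<^sup>2)"
        by blast
      have "0 \<le> real N / s" using s by simp
      hence "0 \<le> z" using z(1) by linarith
      hence "z\<^sup>2 \<le> (real (Suc N) / s)\<^sup>2" using z(2) by (intro power_mono) auto
      hence "inverse (1 + (real (Suc N) / s)\<^sup>2) \<le> inverse (1 + z\<^sup>2)"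
        by (intro le_imp_inverse_le) (auto intro: add_pos_nonneg)
      hence "(1 / s) * inverse (1 + (real (Suc N) / s)\<^sup>2) \<le> (1 / s) * inverse (1 + z\<^sup>2)"
        using s by (intro mult_left_mono) auto
      also have "\<dots> = arctan (real (Suc N) / s) - arctan (real N / s)"
        unfolding eq by (simp add: diff_divide_distrib[symmetric])
      finally have "(1 / s) * inverse (1 + (real (Suc N) / s)\<^sup>2) \<le>
          arctan (real (Suc N) / s) - arctan (real N / s)" .
      moreover have "(1 / s) * inverse (1 + (real (Suc N) / s)\<^sup>2) = profile s (int (Suc N))"
      proof -
        have *: "(1 / s) * inverse (1 + (y / s)\<^sup>2) = s / (s\<^sup>2 + y\<^sup>2)" for y
          using s by (simp add: divide_simps power2_eq_square)
        show ?thesis unfolding profile_def * by simp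
      qed
      ultimately show ?thesis by simp
    qed
    have "profile s (- int (Suc N)) = profile s (int (Suc N))" by (rule profile_minus)
    moreover have "{- int (Suc N)..int (Suc N)} =
        insert (int (Suc N)) (insert (- int (Suc N)) {- int N..int N})" by auto
    ultimately have "sum (profile s) {- int (Suc N)..int (Suc N)} =
        2 * profile s (int (Suc N)) + sum (profile s) {- int N..int N}" by simp
    thus ?case using step Suc.IH by linarith
  qed (simp add: profile_def)
  define N where "N = nat (Max (insert 0 (abs ` F)))"
  have "\<bar>k\<bar> \<le> Max (insert 0 (abs ` F))" if "k \<in> F" for k
    using that \<open>finite F\<close> by (intro Max_ge) auto
  hence "\<bar>k\<bar> \<le> int N" if "k \<in> F" for k using that by (fastforce simp: N_def)
  hence "F \<subseteq> {- int N..int N}" by (force simp: abs_le_iff)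
  hence "sum (profile s) F \<le> sum (profile s) {- int N..int N}"
    using s by (intro sum_mono2) (auto simp: profile_nonneg)
  also have "\<dots> \<le> 1 + 2 * arctan (real N / s)" by (rule sym)
  also have "\<dots> \<le> 1 + pi" using arctan_ubound[of "real N / s"] by simp
  finally show ?thesis .
qed

definition conv_const :: real where "conv_const = 16 * (1 + pi)"

lemma conv_const_pos: "0 < conv_const"
  using pi_gt_zero unfolding conv_const_def by (intro mult_pos_pos add_pos_pos) auto

lemma profile_conv_sum_le:
  assumes s: "0 < s" and t: "0 < t" and F: "finite F"
  shows "(\<Sum>k\<in>F. profile s (a - k) * profile t (k - b)) \<le>
    conv_const * profile (sqrt (s\<^sup>2 + t\<^sup>2)) (a - b)"
proof -
  let ?\<rho> = "sqrt (s\<^sup>2 + t\<^sup>2)"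
  have \<rho>: "0 < ?\<rho>" using s t by (simp add: add_pos_pos)
  have "(\<Sum>k\<in>F. profile s (a - k) * profile t (k - b)) \<le>
      (\<Sum>k\<in>F. 8 * profile ?\<rho> (a - b) * (profile s (a - k) + profile t (k - b)))"
  proof (rule sum_mono)
    fix k
    show "profile s (a - k) * profile t (k - b) \<le>
        8 * profile ?\<rho> (a - b) * (profile s (a - k) + profile t (k - b))"
      using profile_mult_le[OF s t, of "a - k" "k - b"] by simp
  qed
  also have "\<dots> = 8 * profile ?\<rho> (a - b) *
      (sum (profile s) ((\<lambda>k. a - k) ` F) + sum (profile t) ((\<lambda>k. k - b) ` F))"
    by (simp add: sum.distrib sum.reindex inj_on_def flip: sum_distrib_left)
  also have "\<dots> \<le> 8 * profile ?\<rho> (a - b) * ((1 + pi) + (1 + pi))"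
    using profile_nonneg[OF \<rho>] F by (intro mult_left_mono add_mono profile_sum_le s t) auto
  finally show ?thesis by (simp add: conv_const_def algebra_simps)
qed

text \<open>
  A finite set of multi-indices lies in a box, and over a box the sum of a product is the product of
  the sums.
\<close>
lemma sum_prod_vec_le:
  fixes f :: "'d::finite \<Rightarrow> int \<Rightarrow> real" and F :: "(int ^ 'd) set"
  assumes nonneg: "\<And>j k. 0 \<le> f j k" and le: "\<And>j B. finite B \<Longrightarrow> sum (f j) B \<le> M j"
    and F: "finite F"
  shows "(\<Sum>\<eta>\<in>F. \<Prod>j\<in>UNIV. f j (\<eta> $ j)) \<le> (\<Prod>j\<in>UNIV. M j)"
proof -
  define B where "B j = (\<lambda>\<eta>. \<eta> $ j) ` F" for j
  have "(\<Sum>\<eta>\<in>F. \<Prod>j\<in>UNIV. f j (\<eta> $ j)) = (\<Sum>g\<in>vec_nth ` F. \<Prod>j\<in>UNIV. f j (g j))"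
    by (subst sum.reindex) (auto simp: inj_on_def vec_nth_inject)
  also have "\<dots> \<le> (\<Sum>g\<in>Pi\<^sub>E UNIV B. \<Prod>j\<in>UNIV. f j (g j))"
    using F by (intro sum_mono2 finite_PiE prod_nonneg) (auto simp: B_def nonneg)
  also have "\<dots> = (\<Prod>j\<in>UNIV. sum (f j) (B j))"
    using F by (intro prod_sum_PiE[symmetric]) (auto simp: B_def)
  also have "\<dots> \<le> (\<Prod>j\<in>UNIV. M j)"
    using F by (intro prod_mono conjI sum_nonneg le nonneg) (auto simp: B_def)
  finally show ?thesis .
qed

definition grid_profile :: "real \<Rightarrow> int ^ 'd::finite \<Rightarrow> real" where
  "grid_profile s \<alpha> = (\<Prod>j\<in>UNIV. profile s (\<alpha> $ j))"

lemma grid_profile_nonneg: "0 < s \<Longrightarrow> 0 \<le> grid_profile s \<alpha>"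
  by (simp add: grid_profile_def prod_nonneg profile_nonneg)

text \<open>
  The summand factorizes over the coordinates, so the one-dimensional estimate bounds all finite
  partial sums.
\<close>
lemma grid_profile_conv:
  fixes \<alpha> \<beta> :: "int ^ 'd::finite"
  assumes s: "0 < s" and t: "0 < t"
  shows "(\<lambda>\<eta>. grid_profile s (\<alpha> - \<eta>) * grid_profile t (\<eta> - \<beta>)) summable_on UNIV" (is ?S)
    and "(\<Sum>\<^sub>\<infinity>\<eta>. grid_profile s (\<alpha> - \<eta>) * grid_profile t (\<eta> - \<beta>)) \<le>
      conv_const ^ CARD('d) * grid_profile (sqrt (s\<^sup>2 + t\<^sup>2)) (\<alpha> - \<beta>)" (is ?L)
proof -
  let ?b = "conv_const ^ CARD('d) * grid_profile (sqrt (s\<^sup>2 + t\<^sup>2)) (\<alpha> - \<beta>)"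
  let ?f = "\<lambda>\<eta>. grid_profile s (\<alpha> - \<eta>) * grid_profile t (\<eta> - \<beta>)"
  have le: "sum ?f F \<le> ?b" if F: "finite F" for F
  proof -
    have "sum ?f F = (\<Sum>\<eta>\<in>F. \<Prod>j\<in>UNIV. profile s (\<alpha> $ j - \<eta> $ j) * profile t (\<eta> $ j - \<beta> $ j))"
      by (simp add: grid_profile_def prod.distrib)
    also have "\<dots> \<le> (\<Prod>j\<in>UNIV. conv_const * profile (sqrt (s\<^sup>2 + t\<^sup>2)) (\<alpha> $ j - \<beta> $ j))"
      using s t F
      by (intro sum_prod_vec_le[where
            f = "\<lambda>j k. profile s (\<alpha> $ j - k) * profile t (k - \<beta> $ j)"])
        (auto simp: profile_nonneg profile_conv_sum_le)
    also have "\<dots> = ?b" by (simp add: grid_profile_def prod.distrib)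
    finally show ?thesis .
  qed
  show ?S
    using le s t by (intro nonneg_bdd_above_summable_on bdd_aboveI[of _ ?b])
      (auto simp: grid_profile_nonneg)
  thus ?L using le by (intro infsum_le_finite_sums) auto
qed

section \<open>The parametrix kernel\<close>

lemma diff_plus_minus:
  assumes "dx \<noteq> 0"
  shows "diff_plus dx j (diff_minus dx j f) \<alpha> =
    (f (\<alpha> + axis j 1) + f (\<alpha> - axis j 1) - 2 * f \<alpha>) / dx\<^sup>2"
  using assms by (simp add: diff_plus_def diff_minus_def field_simps power2_eq_square)

lemma param_kernel_walk:
  fixes c :: "'d::finite \<Rightarrow> int ^ 'd \<Rightarrow> real"
  assumes "dx \<noteq> 0"
  defines "r \<equiv> \<lambda>\<beta> t i. 2 * c i \<beta> * t / dx\<^sup>2"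
  shows "param_kernel dx c t \<alpha> \<beta> = inverse (dx ^ CARD('d) * dx\<^sup>2) *
    (\<Sum>j\<in>UNIV. (c j \<alpha> - c j \<beta>) * (walk_lap (\<alpha> $ j - \<beta> $ j) (r \<beta> t j) *
      (\<Prod>i\<in>UNIV - {j}. walk (\<alpha> $ i - \<beta> $ i) (r \<beta> t i))))"
proof -
  have fk: "frozen_kernel dx c t \<gamma> \<beta> = inverse (dx ^ CARD('d)) * (\<Prod>i\<in>UNIV. walk (\<gamma> $ i) (r \<beta> t i))" for \<gamma>
    by (simp add: frozen_kernel_def walk_def r_def Let_def)
  have split: "(\<Prod>i\<in>UNIV. walk (\<gamma> $ i) (r \<beta> t i)) = walk (\<gamma> $ j) (r \<beta> t j) *
      (\<Prod>i\<in>UNIV - {j}. walk (\<alpha> $ i - \<beta> $ i) (r \<beta> t i))"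
    if "\<And>i. i \<noteq> j \<Longrightarrow> \<gamma> $ i = \<alpha> $ i - \<beta> $ i" for \<gamma> j
    using that by (subst prod.remove[of UNIV j]) (auto intro!: prod.cong)
  have "diff_plus dx j (diff_minus dx j (\<lambda>\<gamma>. frozen_kernel dx c t (\<gamma> - \<beta>) \<beta>)) \<alpha> =
      inverse (dx ^ CARD('d) * dx\<^sup>2) * (walk_lap (\<alpha> $ j - \<beta> $ j) (r \<beta> t j) *
      (\<Prod>i\<in>UNIV - {j}. walk (\<alpha> $ i - \<beta> $ i) (r \<beta> t i)))" for j
  proof -
    have 1: "(\<Prod>i\<in>UNIV. walk ((\<alpha> + axis j 1 - \<beta>) $ i) (r \<beta> t i)) =
        walk (\<alpha> $ j - \<beta> $ j + 1) (r \<beta> t j) *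
        (\<Prod>i\<in>UNIV - {j}. walk (\<alpha> $ i - \<beta> $ i) (r \<beta> t i))"
      by (subst split[of j]) (auto simp: axis_def algebra_simps)
    have 2: "(\<Prod>i\<in>UNIV. walk ((\<alpha> - axis j 1 - \<beta>) $ i) (r \<beta> t i)) =
        walk (\<alpha> $ j - \<beta> $ j - 1) (r \<beta> t j) *
        (\<Prod>i\<in>UNIV - {j}. walk (\<alpha> $ i - \<beta> $ i) (r \<beta> t i))"
      by (subst split[of j]) (auto simp: axis_def algebra_simps)
    have 3: "(\<Prod>i\<in>UNIV. walk ((\<alpha> - \<beta>) $ i) (r \<beta> t i)) =
        walk (\<alpha> $ j - \<beta> $ j) (r \<beta> t j) *
        (\<Prod>i\<in>UNIV - {j}. walk (\<alpha> $ i - \<beta> $ i) (r \<beta> t i))"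
      by (subst split[of j]) auto
    show ?thesis
      unfolding diff_plus_minus[OF assms(1)] fk 1 2 3 walk_lap_def
      by (simp add: algebra_simps divide_inverse)
  qed
  thus ?thesis by (simp add: param_kernel_def sum_distrib_left mult_ac)
qed

lemma coeff_sup_bounds:
  assumes "admissible dx lo hi L c"
  shows "c j \<alpha> \<le> coeff_sup c" "lo \<le> coeff_sup c" "coeff_sup c \<le> hi"
proof -
  have bounds: "lo \<le> c j \<alpha>" "c j \<alpha> \<le> hi" for j \<alpha>
    using assms by (auto simp: admissible_def)
  have bdd: "bdd_above ((\<lambda>(j, \<alpha>). c j \<alpha>) ` UNIV)"
    by (rule bdd_aboveI[where M = hi]) (auto simp: bounds)
  show ge: "c j \<alpha> \<le> coeff_sup c" for j \<alpha>
    unfolding coeff_sup_def using cSUP_upper[OF _ bdd, of "(j, \<alpha>)"] by simp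
  show "lo \<le> coeff_sup c" using ge bounds order_trans by blast
  show "coeff_sup c \<le> hi"
    unfolding coeff_sup_def by (rule cSUP_least) (auto simp: bounds)
qed

text \<open>
  The diffusive length at time \<open>t\<close>, measured in grid cells.
\<close>
definition heat_scale :: "real \<Rightarrow> ('d::finite \<Rightarrow> int ^ 'd \<Rightarrow> real) \<Rightarrow> real \<Rightarrow> real" where
  "heat_scale dx c t = sqrt (2 * coeff_sup c * t) / dx"

definition heat_majorant ::
  "real \<Rightarrow> ('d::finite \<Rightarrow> int ^ 'd \<Rightarrow> real) \<Rightarrow> real \<Rightarrow> int ^ 'd \<Rightarrow> real" where
  "heat_majorant dx c t \<alpha> = grid_profile (heat_scale dx c t) \<alpha> / dx ^ CARD('d)"

lemma heat_scale_pos: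
  assumes "admissible dx lo hi L c" "0 < t"
  shows "0 < heat_scale dx c t"
  using assms coeff_sup_bounds(2)[OF assms(1)] by (auto simp: heat_scale_def admissible_def)

lemma heat_majorant_nonneg:
  assumes "admissible dx lo hi L c" "0 < t"
  shows "0 \<le> heat_majorant dx c t \<alpha>"
  unfolding heat_majorant_def using assms(1)
  by (intro divide_nonneg_nonneg grid_profile_nonneg heat_scale_pos[OF assms])
    (simp add: admissible_def)

lemma comparable_scales_coeff:
  assumes adm: "admissible dx lo hi L c" and "0 < t"
  shows "comparable_scales (sqrt (lo / hi)) (heat_scale dx c t) (sqrt (2 * c j \<beta> * t / dx\<^sup>2))"
proof
  have dx: "0 < dx" and lo: "0 < lo" "lo \<le> c j \<beta>"
    using adm by (auto simp: admissible_def)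
  note cs = coeff_sup_bounds[OF adm]
  have hi: "lo \<le> hi" "0 < hi" using cs lo by auto
  show "0 < sqrt (lo / hi)" "sqrt (lo / hi) \<le> 1" using lo hi by simp_all
  show "0 < heat_scale dx c t" by (rule heat_scale_pos) fact+
  have eq: "sqrt (2 * a * t / dx\<^sup>2) = sqrt (2 * a * t) / dx" for a
    using dx by (simp add: real_sqrt_divide)
  have "lo / hi * coeff_sup c \<le> lo * 1"
    using mult_left_mono[of "coeff_sup c" hi lo] cs hi lo by (simp add: field_simps)
  hence "lo / hi * coeff_sup c \<le> c j \<beta>" using lo by simp
  hence "lo / hi * coeff_sup c * (2 * t) \<le> c j \<beta> * (2 * t)"
    using \<open>0 < t\<close> by (intro mult_right_mono) auto
  hence "sqrt (lo / hi * (2 * coeff_sup c * t)) \<le> sqrt (2 * c j \<beta> * t)"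
    by (simp add: mult_ac)
  thus "sqrt (lo / hi) * heat_scale dx c t \<le> sqrt (2 * c j \<beta> * t / dx\<^sup>2)"
    unfolding eq heat_scale_def real_sqrt_mult[of "lo / hi"] using dx by (simp add: divide_right_mono)
  have "sqrt (2 * c j \<beta> * t) \<le> sqrt (2 * coeff_sup c * t)"
    using cs(1)[of j \<beta>] \<open>0 < t\<close> by simp
  thus "sqrt (2 * c j \<beta> * t / dx\<^sup>2) \<le> heat_scale dx c t"
    unfolding eq heat_scale_def using dx by (simp add: divide_right_mono)
qed

definition kernel_const :: "real \<Rightarrow> real \<Rightarrow> real \<Rightarrow> nat \<Rightarrow> real" where
  "kernel_const lo hi L d =
    \<bar>L\<bar> * (real d)\<^sup>2 * walk_const (sqrt (lo / hi)) ^ d / sqrt (2 * lo)"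

text \<open>
  The Lipschitz condition turns \<open>c_\<alpha> - c_\<beta>\<close> into \<open>L dx\<close> times the sum of the \<open>\<bar>n_i\<bar>\<close>, where \<open>n = \<alpha> - \<beta>\<close>.
  Each second difference costs \<open>1 / s\<^sup>2\<close> and each factor \<open>\<bar>n_i\<bar>\<close> gains \<open>s\<close>, also when both fall on the
  same coordinate. The net factor \<open>1 / (dx s)\<close> is of order \<open>1 / sqrt t\<close>.
\<close>
lemma param_kernel_bound:
  fixes c :: "'d::finite \<Rightarrow> int ^ 'd \<Rightarrow> real"
  assumes adm: "admissible dx lo hi L c" and t: "0 < t"
  shows "\<bar>param_kernel dx c t \<alpha> \<beta>\<bar> \<le>
    kernel_const lo hi L CARD('d) * t powr (- 1 / 2) * heat_majorant dx c t (\<alpha> - \<beta>)"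
proof -
  have dx: "0 < dx" and lo: "0 < lo" using adm by (auto simp: admissible_def)
  define s where "s = heat_scale dx c t"
  have s: "0 < s" unfolding s_def by (rule heat_scale_pos) fact+
  define K where "K = walk_const (sqrt (lo / hi))"
  define r where "r i = 2 * c i \<beta> * t / dx\<^sup>2" for i
  define n where "n i = \<alpha> $ i - \<beta> $ i" for i
  define q where "q i = \<bar>walk (n i) (r i)\<bar>" for i
  define l where "l i = \<bar>walk_lap (n i) (r i)\<bar>" for i
  let ?d = "CARD('d)" and ?P = "grid_profile s (\<alpha> - \<beta>)"
  have P: "0 \<le> ?P" by (rule grid_profile_nonneg[OF s])
  interpret cs: comparable_scales "sqrt (lo / hi)" s "sqrt (r i)" for i
    unfolding s_def r_def by (rule comparable_scales_coeff) fact+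
  have r: "(sqrt (r i))\<^sup>2 = r i" for i
    using adm t lo by (auto simp: r_def admissible_def intro!: divide_nonneg_nonneg mult_nonneg_nonneg
        intro: less_imp_le order_trans)
  have K: "0 \<le> K" using cs.K_ge(1) by (simp add: K_def)
  note b = cs.walk_le_profile[of "n i" i for i, unfolded r, folded q_def K_def]
    cs.index_walk_le_profile[of "n i" i for i, unfolded r, folded q_def K_def]
    cs.walk_lap_le_profile[of "n i" i for i, unfolded r, folded l_def K_def]
    cs.index_walk_lap_le_profile[of "n i" i for i, unfolded r, folded l_def K_def]
  have summand: "\<bar>of_int (n i)\<bar> * (l j * (\<Prod>k\<in>UNIV - {j}. q k)) \<le> K ^ ?d * ?P / s" for i j
  proof -
    \<comment> \<open>The factors \<open>s\<^sup>2\<close> of the second difference in direction \<open>j\<close> and \<open>\<bar>n_i\<bar> / s\<close> are attached to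
      their coordinates; for \<open>i = j\<close> both go to the same one. Each \<open>z k\<close> is then at most \<open>K\<close> times one profile.\<close>
    define z where "z k = (if k = j then s\<^sup>2 * l k else q k) *
      (if k = i then \<bar>of_int (n i)\<bar> / s else 1)" for k
    have z: "0 \<le> z k \<and> z k \<le> K * profile s (n k)" for k
    proof
      show "0 \<le> z k" using s by (simp add: z_def l_def q_def)
      show "z k \<le> K * profile s (n k)"
        using b[of k] s by (auto simp: z_def field_simps power2_eq_square)
    qed
    have "(\<Prod>k\<in>UNIV. if k = j then s\<^sup>2 * l k else q k) = s\<^sup>2 * l j * (\<Prod>k\<in>UNIV - {j}. q k)"
      by (subst prod.remove[of UNIV j]) (auto intro!: prod.cong)
    hence "(\<Prod>k\<in>UNIV. z k) = s\<^sup>2 * l j * (\<Prod>k\<in>UNIV - {j}. q k) * (\<bar>of_int (n i)\<bar> / s)"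
      by (simp add: z_def prod.distrib prod.delta)
    also have "\<dots> = s * (\<bar>of_int (n i)\<bar> * (l j * (\<Prod>k\<in>UNIV - {j}. q k)))"
      using s by (simp add: field_simps power2_eq_square)
    finally have "s * (\<bar>of_int (n i)\<bar> * (l j * (\<Prod>k\<in>UNIV - {j}. q k))) = (\<Prod>k\<in>UNIV. z k)" ..
    also have "\<dots> \<le> (\<Prod>k\<in>UNIV. K * profile s (n k))" by (rule prod_mono) (rule z)
    also have "\<dots> = K ^ ?d * ?P" by (simp add: prod.distrib grid_profile_def n_def)
    finally show ?thesis using s by (simp add: field_simps)
  qed
  have lip: "\<bar>c j \<alpha> - c j \<beta>\<bar> \<le> \<bar>L\<bar> * dx * (\<Sum>i\<in>UNIV. \<bar>of_int (n i)\<bar>)" for j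
  proof -
    have "\<bar>c j \<alpha> - c j \<beta>\<bar> \<le> L * norm (gridpt dx \<alpha> - gridpt dx \<beta>)"
      using adm by (auto simp: admissible_def)
    also have "\<dots> \<le> \<bar>L\<bar> * norm (gridpt dx \<alpha> - gridpt dx \<beta>)" by (intro mult_right_mono) auto
    also have "norm (gridpt dx \<alpha> - gridpt dx \<beta>) \<le>
        (\<Sum>i\<in>UNIV. \<bar>(gridpt dx \<alpha> - gridpt dx \<beta>) $ i\<bar>)" by (rule norm_le_l1_cart)
    also have "\<dots> = dx * (\<Sum>i\<in>UNIV. \<bar>of_int (n i)\<bar>)"
    proof -
      have "\<bar>(gridpt dx \<alpha> - gridpt dx \<beta>) $ i\<bar> = dx * \<bar>of_int (n i)\<bar>" for i
        using dx abs_mult[of dx "of_int (n i)"] by (simp add: gridpt_def n_def algebra_simps)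
      thus ?thesis by (simp add: sum_distrib_left)
    qed
    finally show ?thesis by (simp add: mult_left_mono)
  qed
  have "\<bar>param_kernel dx c t \<alpha> \<beta>\<bar> = inverse (dx ^ ?d * dx\<^sup>2) *
      \<bar>\<Sum>j\<in>UNIV. (c j \<alpha> - c j \<beta>) * (walk_lap (n j) (r j) * (\<Prod>k\<in>UNIV - {j}. walk (n k) (r k)))\<bar>"
    using dx by (simp add: param_kernel_walk abs_mult n_def r_def)
  also have "\<dots> \<le> inverse (dx ^ ?d * dx\<^sup>2) * (\<Sum>j\<in>(UNIV :: 'd set). \<Sum>i\<in>(UNIV :: 'd set). \<bar>L\<bar> * dx * (K ^ ?d * ?P / s))"
  proof (intro mult_left_mono order_trans[OF sum_abs] sum_mono)
    fix j
    have nonneg: "0 \<le> l j * (\<Prod>k\<in>UNIV - {j}. q k)"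
      by (simp add: l_def q_def prod_nonneg)
    have "\<bar>(c j \<alpha> - c j \<beta>) * (walk_lap (n j) (r j) * (\<Prod>k\<in>UNIV - {j}. walk (n k) (r k)))\<bar> =
        \<bar>c j \<alpha> - c j \<beta>\<bar> * (l j * (\<Prod>k\<in>UNIV - {j}. q k))"
      by (simp add: abs_mult abs_prod l_def q_def)
    also have "\<dots> \<le> (\<bar>L\<bar> * dx * (\<Sum>i\<in>UNIV. \<bar>of_int (n i)\<bar>)) * (l j * (\<Prod>k\<in>UNIV - {j}. q k))"
      using lip nonneg by (rule mult_right_mono)
    also have "\<dots> = (\<Sum>i\<in>UNIV. \<bar>L\<bar> * dx * (\<bar>of_int (n i)\<bar> * (l j * (\<Prod>k\<in>UNIV - {j}. q k))))"
      by (simp add: sum_distrib_left sum_distrib_right mult_ac)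
    also have "\<dots> \<le> (\<Sum>i\<in>(UNIV :: 'd set). \<bar>L\<bar> * dx * (K ^ ?d * ?P / s))"
      using dx summand by (intro sum_mono mult_left_mono) auto
    finally show "\<bar>(c j \<alpha> - c j \<beta>) * (walk_lap (n j) (r j) * (\<Prod>k\<in>UNIV - {j}. walk (n k) (r k)))\<bar> \<le>
        (\<Sum>i\<in>(UNIV :: 'd set). \<bar>L\<bar> * dx * (K ^ ?d * ?P / s))" .
  qed (use dx in auto)
  also have "\<dots> = \<bar>L\<bar> * (real ?d)\<^sup>2 * K ^ ?d * (1 / (s * dx)) * (?P / dx ^ ?d)"
    using dx s by (simp add: field_simps power2_eq_square)
  also have "\<dots> \<le> \<bar>L\<bar> * (real ?d)\<^sup>2 * K ^ ?d * (t powr (- 1 / 2) / sqrt (2 * lo)) * (?P / dx ^ ?d)"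
  proof (intro mult_right_mono mult_left_mono)
    have "sqrt (2 * lo) * sqrt t \<le> s * dx"
      using dx t coeff_sup_bounds(2)[OF adm]
      by (simp add: s_def heat_scale_def flip: real_sqrt_mult)
    hence "1 / (s * dx) \<le> 1 / (sqrt (2 * lo) * sqrt t)"
      using lo t s dx by (intro divide_left_mono mult_pos_pos) auto
    thus "1 / (s * dx) \<le> t powr (- 1 / 2) / sqrt (2 * lo)"
      using t by (simp add: powr_minus powr_half_sqrt field_simps)
  qed (use dx P K in auto)
  also have "\<dots> \<le> kernel_const lo hi L ?d * t powr (- 1 / 2) * (?P / dx ^ ?d)"
  proof (intro mult_right_mono)
    have "0 \<le> t powr (- 1 / 2)" by simp
    thus "\<bar>L\<bar> * (real ?d)\<^sup>2 * K ^ ?d * (t powr (- 1 / 2) / sqrt (2 * lo)) \<le>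
        kernel_const lo hi L ?d * t powr (- 1 / 2)"
      by (simp add: kernel_const_def K_def distrib_right)
  qed (use dx P in auto)
  finally show ?thesis by (simp add: heat_majorant_def s_def)
qed

text \<open>
  The weight \<open>dx\<^sup>d\<close> of the convolution cancels one of the two normalizations, and the squares of the
  scales add up like the times.
\<close>
lemma disc_conv_bound:
  fixes c :: "'d::finite \<Rightarrow> int ^ 'd \<Rightarrow> real"
  assumes adm: "admissible dx lo hi L c" and u: "0 < u" and w: "0 < w" and "0 \<le> a" "0 \<le> b"
    and F: "\<And>\<eta>. \<bar>F \<alpha> \<eta>\<bar> \<le> a * heat_majorant dx c u (\<alpha> - \<eta>)"
    and G: "\<And>\<eta>. \<bar>G \<eta> \<beta>\<bar> \<le> b * heat_majorant dx c w (\<eta> - \<beta>)"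
  shows "\<bar>disc_conv dx F G \<alpha> \<beta>\<bar> \<le>
    a * b * conv_const ^ CARD('d) * heat_majorant dx c (u + w) (\<alpha> - \<beta>)"
proof -
  let ?d = "CARD('d)"
  let ?s = "heat_scale dx c u" and ?t = "heat_scale dx c w"
  have dx: "0 < dx" using adm by (simp add: admissible_def)
  have s: "0 < ?s" "0 < ?t" using heat_scale_pos[OF adm] u w by auto
  have scales: "sqrt (?s\<^sup>2 + ?t\<^sup>2) = heat_scale dx c (u + w)"
  proof -
    have "0 < coeff_sup c" using coeff_sup_bounds(2)[OF adm] adm by (auto simp: admissible_def)
    hence "?s\<^sup>2 + ?t\<^sup>2 = (2 * coeff_sup c * (u + w)) / dx\<^sup>2"
      using u w dx by (simp add: heat_scale_def power_divide add_divide_distrib distrib_left)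
    thus ?thesis using dx by (simp add: heat_scale_def real_sqrt_divide)
  qed
  let ?g = "\<lambda>\<eta>. grid_profile ?s (\<alpha> - \<eta>) * grid_profile ?t (\<eta> - \<beta>)"
  let ?h = "\<lambda>\<eta>. a * b / dx ^ ?d * ?g \<eta>"
  have h: "?h summable_on UNIV"
    by (intro summable_on_cmult_right grid_profile_conv s)
  have le: "norm (F \<alpha> \<eta> * G \<eta> \<beta> * dx ^ ?d) \<le> ?h \<eta>" for \<eta>
  proof -
    have "\<bar>F \<alpha> \<eta>\<bar> * \<bar>G \<eta> \<beta>\<bar> * dx ^ ?d \<le>
        (a * heat_majorant dx c u (\<alpha> - \<eta>)) * (b * heat_majorant dx c w (\<eta> - \<beta>)) * dx ^ ?d"
      using dx heat_majorant_nonneg[OF adm u] assms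
      by (intro mult_right_mono mult_mono F G) auto
    also have "\<dots> = ?h \<eta>" using dx by (simp add: heat_majorant_def field_simps)
    finally show ?thesis using dx by (simp add: abs_mult)
  qed
  have abs: "(\<lambda>\<eta>. norm (F \<alpha> \<eta> * G \<eta> \<beta> * dx ^ ?d)) summable_on UNIV"
    using h le by (rule Infinite_Sum.abs_summable_on_comparison_test')
  have "norm (disc_conv dx F G \<alpha> \<beta>) \<le> (\<Sum>\<^sub>\<infinity>\<eta>. norm (F \<alpha> \<eta> * G \<eta> \<beta> * dx ^ ?d))"
    unfolding disc_conv_def by (rule norm_infsum_bound[OF abs])
  also have "\<dots> \<le> infsum ?h UNIV"
    by (rule infsum_mono[OF abs h le])
  also have "\<dots> = a * b / dx ^ ?d * infsum ?g UNIV"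
    by (rule infsum_cmult_right) (intro grid_profile_conv s)
  also have "\<dots> \<le> a * b / dx ^ ?d *
      (conv_const ^ ?d * grid_profile (sqrt (?s\<^sup>2 + ?t\<^sup>2)) (\<alpha> - \<beta>))"
    using assms dx by (intro mult_left_mono grid_profile_conv s) auto
  also have "\<dots> = a * b * conv_const ^ ?d * heat_majorant dx c (u + w) (\<alpha> - \<beta>)"
    by (simp add: scales heat_majorant_def)
  finally show ?thesis by simp
qed

section \<open>The iterated kernels\<close>

lemma lborel_integral_of_has_integral:
  fixes f :: "real \<Rightarrow> real"
  assumes int: "(f has_integral I) S" and nonneg: "\<And>x. x \<in> S \<Longrightarrow> 0 \<le> f x"
    and [measurable]: "f \<in> borel_measurable borel" "S \<in> sets borel"
  shows "set_integrable lborel S f" "(LBINT x:S. f x) = I"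
proof -
  have "f absolutely_integrable_on S"
    using int nonneg by (intro nonnegative_absolutely_integrable_1) (auto simp: has_integral_integrable)
  thus 1: "set_integrable lborel S f"
    unfolding set_integrable_def by (subst (asm) integrable_completion) measurable
  show "(LBINT x:S. f x) = I"
    using set_borel_integral_eq_integral(2)[OF 1] int by (simp add: integral_unique)
qed

text \<open>
  The substitution \<open>s = t x\<close> reduces this to Euler's Beta integral.
\<close>
lemma singular_convolution_integral:
  fixes t :: real
  assumes "0 < t"
  shows "set_integrable lborel {0..t} (\<lambda>s. s powr (- 1 / 2) * (t - s) powr (- 3 / 4))"
    and "(LBINT s:{0..t}. s powr (- 1 / 2) * (t - s) powr (- 3 / 4)) = Beta (1 / 2) (1 / 4) * t powr (- 1 / 4)"
proof -
  let ?f = "\<lambda>s. s powr (- 1 / 2) * (t - s) powr (- 3 / 4)"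
  let ?g = "\<lambda>x. x powr (- 1 / 2) * (1 - x) powr (- 3 / 4) :: real"
  have "(?g has_integral Beta (1 / 2) (1 / 4)) {0..1}"
    using has_integral_Beta_real[of "1 / 2" "1 / 4"] by simp
  from has_integral_stretch_real[OF this, of "1 / t"] assms
  have "((\<lambda>s. ?g (s / t)) has_integral t * Beta (1 / 2) (1 / 4)) {0..t}"
    by (simp add: image_mult_atLeastAtMost_if')
  hence scaled: "((\<lambda>s. t powr (- 5 / 4) * ?g (s / t)) has_integral t powr (- 5 / 4) * (t * Beta (1 / 2) (1 / 4))) {0..t}"
    by (rule has_integral_mult_right)
  have eq: "t powr (- 5 / 4) * ?g (s / t) = ?f s" if "s \<in> {0..t}" for s
  proof -
    have "1 - s / t = (t - s) / t" using assms by (simp add: field_simps)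
    moreover have "t powr (- 5 / 4) = t powr (- 1 / 2) * t powr (- 3 / 4)"
      by (simp flip: powr_add)
    ultimately show ?thesis
      using assms that by (simp add: powr_divide)
  qed
  have "t powr (- 5 / 4) * t = t powr (- 1 / 4)"
    using powr_add[of t "- 5 / 4" 1] assms by simp
  hence val: "t powr (- 5 / 4) * (t * Beta (1 / 2) (1 / 4)) = Beta (1 / 2) (1 / 4) * t powr (- 1 / 4)"
    by (metis mult.assoc mult.commute)
  have "(?f has_integral Beta (1 / 2) (1 / 4) * t powr (- 1 / 4)) {0..t}"
    using has_integral_eq[OF eq scaled] unfolding val .
  thus "set_integrable lborel {0..t} ?f" "(LBINT s:{0..t}. ?f s) = Beta (1 / 2) (1 / 4) * t powr (- 1 / 4)"
    by (rule lborel_integral_of_has_integral; simp)+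
qed

lemma AE_lborel_interior:
  fixes a b :: real
  assumes "\<And>s. a < s \<Longrightarrow> s < b \<Longrightarrow> P s"
  shows "AE s in lborel. s \<in> {a..b} \<longrightarrow> P s"
  using AE_lborel_singleton[of a] AE_lborel_singleton[of b]
  by eventually_elim (use assms in auto)

text \<open>
  If \<open>f\<close> is not integrable, its Bochner integral is \<open>0\<close> and the claim is that \<open>g\<close> has a nonnegative
  integral. So the iterated kernels can be estimated by induction on their size alone.
\<close>
lemma set_integral_abs_bound:
  fixes f g :: "real \<Rightarrow> real"
  assumes g: "set_integrable lborel {a..b} g" and le: "\<And>s. a < s \<Longrightarrow> s < b \<Longrightarrow> \<bar>f s\<bar> \<le> g s"
  shows "\<bar>LBINT s:{a..b}. f s\<bar> \<le> (LBINT s:{a..b}. g s)"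
proof (cases "set_integrable lborel {a..b} f")
  case True
  have "\<bar>LBINT s:{a..b}. f s\<bar> \<le> (LBINT s:{a..b}. \<bar>f s\<bar>)"
    using set_integral_norm_bound[OF True] by simp
  also have "\<dots> \<le> (LBINT s:{a..b}. g s)"
    using AE_lborel_interior[of a b "\<lambda>s. \<bar>f s\<bar> \<le> g s"] le
    by (intro set_integral_mono_AE set_integrable_abs True g) auto
  finally show ?thesis .
next
  case False
  have "AE s in lborel. s \<in> {a..b} \<longrightarrow> 0 \<le> g s"
    using le by (intro AE_lborel_interior) (meson abs_ge_zero order_trans)
  hence "0 \<le> (LBINT s:{a..b}. g s)"
    unfolding set_lebesgue_integral_def
    by (intro integral_nonneg_AE) (auto simp: indicator_def elim!: eventually_mono)
  thus ?thesis using False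
    by (simp add: set_lebesgue_integral_def set_integrable_def not_integrable_integral_eq)
qed

lemma exp_minus_le_powr:
  assumes "0 < (y::real)" shows "exp (- y) \<le> y powr (- 1 / 4)"
proof -
  have "ln y / 4 \<le> y"
    using ln_le_minus_one[OF assms] assms by (cases "0 \<le> ln y") auto
  thus ?thesis using assms by (simp add: powr_def)
qed

text \<open>
  The exponential weight makes convolution with \<open>1 / sqrt t\<close> small on \<open>[0, T]\<close>: the bound
  \<open>exp (- y) \<le> y powr (- 1 / 4)\<close> at \<open>y = \<mu> (t - s)\<close> buys the factor \<open>\<mu> powr (- 1 / 4)\<close> and leaves
  the integrable singularity \<open>(t - s) powr (- 3 / 4)\<close>.
\<close>
lemma weighted_convolution_integral:
  fixes t \<mu> :: real
  assumes t: "0 < t" "t \<le> T" and lam: "0 < \<mu>" and M: "0 \<le> M"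
    and f: "\<And>s. 0 < s \<Longrightarrow> s < t \<Longrightarrow>
      \<bar>f s\<bar> \<le> M * ((t - s) powr (- 1 / 2) * (exp (\<mu> * s) * s powr (- 1 / 2)))"
  shows "\<bar>LBINT s:{0..t}. f s\<bar> \<le>
    M * (Beta (1 / 2) (1 / 4) * (T / \<mu>) powr (1 / 4)) * (exp (\<mu> * t) * t powr (- 1 / 2))"
proof -
  let ?M = "M * exp (\<mu> * t) * \<mu> powr (- 1 / 4)"
  let ?g = "\<lambda>s. s powr (- 1 / 2) * (t - s) powr (- 3 / 4)"
  have B: "0 \<le> Beta (1 / 2) (1 / 4 :: real)"
    by (simp add: Beta_def Gamma_real_nonneg)
  have "\<bar>LBINT s:{0..t}. f s\<bar> \<le> (LBINT s:{0..t}. ?M * ?g s)"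
  proof (rule set_integral_abs_bound)
    show "set_integrable lborel {0..t} (\<lambda>s. ?M * ?g s)"
      using singular_convolution_integral(1)[OF t(1)] by (intro set_integrable_mult_right) auto
    fix s assume s: "0 < s" "s < t"
    have "exp (\<mu> * s) = exp (\<mu> * t) * exp (- (\<mu> * (t - s)))"
      by (simp add: algebra_simps flip: exp_add)
    also have "\<dots> \<le> exp (\<mu> * t) * (\<mu> * (t - s)) powr (- 1 / 4)"
      using s lam by (intro mult_left_mono exp_minus_le_powr) auto
    also have "\<dots> = exp (\<mu> * t) * \<mu> powr (- 1 / 4) * (t - s) powr (- 1 / 4)"
      using s lam by (simp add: powr_mult)
    finally have e: "exp (\<mu> * s) \<le> exp (\<mu> * t) * \<mu> powr (- 1 / 4) * (t - s) powr (- 1 / 4)" .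
    have p: "(t - s) powr (- 1 / 4) * (t - s) powr (- 1 / 2) = (t - s) powr (- 3 / 4)"
      by (simp flip: powr_add)
    have "\<bar>f s\<bar> \<le> M * ((t - s) powr (- 1 / 2) *
        ((exp (\<mu> * t) * \<mu> powr (- 1 / 4) * (t - s) powr (- 1 / 4)) * s powr (- 1 / 2)))"
      using f[OF s] by (rule order_trans) (intro mult_left_mono mult_right_mono e M; simp)
    also have "\<dots> = ?M * ?g s" unfolding p[symmetric] by (simp add: mult_ac)
    finally show "\<bar>f s\<bar> \<le> ?M * ?g s" .
  qed
  also have "\<dots> = ?M * (Beta (1 / 2) (1 / 4) * t powr (- 1 / 4))"
    unfolding set_integral_mult_right singular_convolution_integral(2)[OF t(1)] ..
  also have "\<dots> = M * (Beta (1 / 2) (1 / 4) * (\<mu> powr (- 1 / 4) * t powr (1 / 4))) *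
      (exp (\<mu> * t) * t powr (- 1 / 2))"
  proof -
    have "t powr (- 1 / 4) = t powr (1 / 4) * t powr (- 1 / 2)" by (simp flip: powr_add)
    thus ?thesis by (simp add: mult_ac)
  qed
  also have "\<dots> \<le> M * (Beta (1 / 2) (1 / 4) * (T / \<mu>) powr (1 / 4)) * (exp (\<mu> * t) * t powr (- 1 / 2))"
  proof (intro mult_right_mono mult_left_mono M B)
    have "t powr (1 / 4) \<le> T powr (1 / 4)" using t by (intro powr_mono2) auto
    hence "\<mu> powr (- 1 / 4) * t powr (1 / 4) \<le> \<mu> powr (- 1 / 4) * T powr (1 / 4)"
      by (intro mult_left_mono) auto
    also have "\<dots> = (T / \<mu>) powr (1 / 4)"
      using t lam by (simp add: powr_divide powr_minus_divide)
    finally show "\<mu> powr (- 1 / 4) * t powr (1 / 4) \<le> (T / \<mu>) powr (1 / 4)" .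
  qed auto
  finally show ?thesis .
qed

text \<open>
  Each further convolution reproduces the spatial majorant up to a constant by \<open>disc_conv_bound\<close>, while
  its time integral contributes \<open>(T / \<mu>) powr (1 / 4)\<close>. Taking \<open>\<mu>\<close> large makes the product of the two at
  most \<open>1 / 2\<close>.
\<close>
lemma iter_kernel_bound:
  fixes lo hi L T :: real
  assumes "0 < T"
  obtains \<mu> where "0 < \<mu>"
    and "\<And>dx (c :: 'd::finite \<Rightarrow> int ^ 'd \<Rightarrow> real) m t \<alpha> \<beta>.
      admissible dx lo hi L c \<Longrightarrow> 0 < t \<Longrightarrow> t \<le> T \<Longrightarrow>
      \<bar>iter_kernel dx c m t \<alpha> \<beta>\<bar> \<le> kernel_const lo hi L CARD('d) * (1 / 2) ^ m *
        (exp (\<mu> * t) * t powr (- 1 / 2)) * heat_majorant dx c t (\<alpha> - \<beta>)"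
proof -
  define A where "A = kernel_const lo hi L CARD('d)"
  define B :: real where "B = Beta (1 / 2) (1 / 4)"
  \<comment> \<open>\<open>R\<close> exceeds twice the constant gained in one convolution step, and \<open>\<mu>\<close> is chosen such that
    \<open>(T / \<mu>) powr (1 / 4) = 1 / R\<close>; the summand \<open>1\<close> keeps \<open>R\<close> positive.\<close>
  define R where "R = 1 + 2 * \<bar>A\<bar> * conv_const ^ CARD('d) * B"
  have B: "0 \<le> B"
    by (simp add: B_def Beta_def Gamma_real_nonneg)
  have R: "1 \<le> R" using B conv_const_pos by (simp add: R_def)
  define \<mu> where "\<mu> = T * R powr 4"
  have lam: "0 < \<mu>" using assms R by (simp add: \<mu>_def)
  have TR: "(T / \<mu>) powr (1 / 4) = 1 / R"
    using powr_powr[of R 4 "1 / 4"] assms R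
    by (simp add: \<mu>_def powr_divide del: powr_numeral)
  show ?thesis
  proof (rule that[OF lam, folded A_def])
    fix dx m t \<alpha> \<beta> and c :: "'d \<Rightarrow> int ^ 'd \<Rightarrow> real"
    assume adm: "admissible dx lo hi L c" and t: "0 < t" "t \<le> T"
    have A: "0 \<le> A"
    proof -
      interpret comparable_scales "sqrt (lo / hi)" "heat_scale dx c t" "sqrt (2 * c j \<beta> * t / dx\<^sup>2)" for j
        by (rule comparable_scales_coeff) fact+
      have "0 \<le> walk_const (sqrt (lo / hi))" using K_ge(1) by simp
      thus ?thesis using adm by (auto simp: A_def kernel_const_def admissible_def)
    qed
    show "\<bar>iter_kernel dx c m t \<alpha> \<beta>\<bar> \<le> A * (1 / 2) ^ m *
        (exp (\<mu> * t) * t powr (- 1 / 2)) * heat_majorant dx c t (\<alpha> - \<beta>)"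
      using t
    proof (induction m arbitrary: t \<alpha>)
      case 0
      have "1 * t powr (- 1 / 2) \<le> exp (\<mu> * t) * t powr (- 1 / 2)"
        using lam 0 by (intro mult_right_mono) auto
      hence "A * t powr (- 1 / 2) * heat_majorant dx c t (\<alpha> - \<beta>) \<le>
          A * (exp (\<mu> * t) * t powr (- 1 / 2)) * heat_majorant dx c t (\<alpha> - \<beta>)"
        using A heat_majorant_nonneg[OF adm 0(1)] by (intro mult_right_mono mult_left_mono) auto
      with param_kernel_bound[OF adm 0(1), of \<alpha> \<beta>] show ?case by (simp add: A_def)
    next
      case (Suc m)
      let ?H = "heat_majorant dx c t (\<alpha> - \<beta>)" and ?C = "conv_const ^ CARD('d)"
      let ?M = "A * (A * (1 / 2) ^ m) * ?C * ?H"
      have H: "0 \<le> ?H" by (rule heat_majorant_nonneg[OF adm Suc.prems(1)])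
      have "\<bar>iter_kernel dx c (Suc m) t \<alpha> \<beta>\<bar> \<le> ?M * (B * (T / \<mu>) powr (1 / 4)) *
          (exp (\<mu> * t) * t powr (- 1 / 2))"
        unfolding iter_kernel.simps B_def
      proof (rule weighted_convolution_integral[OF Suc.prems lam])
        show "0 \<le> ?M" using A H conv_const_pos by simp
        fix s assume s: "0 < s" "s < t"
        have "\<bar>disc_conv dx (param_kernel dx c (t - s)) (iter_kernel dx c m s) \<alpha> \<beta>\<bar> \<le>
            (A * (t - s) powr (- 1 / 2)) * (A * (1 / 2) ^ m * (exp (\<mu> * s) * s powr (- 1 / 2))) *
              ?C * heat_majorant dx c (t - s + s) (\<alpha> - \<beta>)"
        proof (rule disc_conv_bound[OF adm])
          show "\<bar>iter_kernel dx c m s \<eta> \<beta>\<bar> \<le> A * (1 / 2) ^ m *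
              (exp (\<mu> * s) * s powr (- 1 / 2)) * heat_majorant dx c s (\<eta> - \<beta>)" for \<eta>
            using s Suc.prems by (intro Suc.IH) auto
          show "\<bar>param_kernel dx c (t - s) \<alpha> \<eta>\<bar> \<le>
              A * (t - s) powr (- 1 / 2) * heat_majorant dx c (t - s) (\<alpha> - \<eta>)" for \<eta>
            unfolding A_def by (rule param_kernel_bound[OF adm]) (use s in simp)
        qed (use s Suc.prems A in simp_all)
        thus "\<bar>disc_conv dx (param_kernel dx c (t - s)) (iter_kernel dx c m s) \<alpha> \<beta>\<bar> \<le>
            ?M * ((t - s) powr (- 1 / 2) * (exp (\<mu> * s) * s powr (- 1 / 2)))"
          by (simp add: mult_ac)
      qed
      also have "\<dots> = (A * ?C * B / R) * (A * (1 / 2) ^ m * (exp (\<mu> * t) * t powr (- 1 / 2)) * ?H)"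
        unfolding TR by simp
      also have "\<dots> \<le> (1 / 2) * (A * (1 / 2) ^ m * (exp (\<mu> * t) * t powr (- 1 / 2)) * ?H)"
      proof (intro mult_right_mono)
        show "A * ?C * B / R \<le> 1 / 2" using R A by (simp add: R_def field_simps)
      qed (use A H in auto)
      finally show ?case by simp
    qed
  qed
qed

section \<open>Measurability\<close>

lemma walk_continuous: "continuous_on UNIV (walk n)"
proof -
  have "continuous_on UNIV (bessel_I n)"
    using bessel_I_deriv by (meson DERIV_isCont continuous_at_imp_continuous_on)
  thus ?thesis unfolding walk_def[abs_def] by (intro continuous_intros)
qed

lemma param_kernel_measurable:
  assumes "dx \<noteq> 0"
  shows "(\<lambda>t. param_kernel dx c t \<alpha> \<beta>) \<in> borel_measurable borel"
proof (rule borel_measurable_continuous_onI)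
  have w: "continuous_on UNIV (\<lambda>t. walk n (2 * c i \<beta> * t / dx\<^sup>2))" for n i
    by (rule continuous_on_compose2[OF walk_continuous]) (use assms in \<open>auto intro!: continuous_intros\<close>)
  show "continuous_on UNIV (\<lambda>t. param_kernel dx c t \<alpha> \<beta>)"
    unfolding param_kernel_walk[OF assms] walk_lap_def by (intro continuous_intros w)
qed

text \<open>
  A real infinite sum is the Bochner integral for the counting measure, also in the divergent case,
  where both are \<open>0\<close> by convention. Hence this is a case of measurability of parameter integrals.
\<close>
lemma borel_measurable_infsum:
  fixes f :: "'a::countable \<Rightarrow> 'b \<Rightarrow> real"
  assumes f: "\<And>i. f i \<in> borel_measurable M"
  shows "(\<lambda>x. infsum (\<lambda>i. f i x) UNIV) \<in> borel_measurable M"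
proof -
  have eq: "infsum g UNIV = lebesgue_integral (count_space UNIV) g" for g :: "'a \<Rightarrow> real"
  proof (cases "Infinite_Set_Sum.abs_summable_on g UNIV")
    case True
    thus ?thesis by (simp add: infsetsum_infsum[symmetric] infsetsum_def)
  next
    case False
    hence "\<not> g summable_on UNIV"
      using abs_summable_equivalent summable_on_iff_abs_summable_on_real by blast
    with False show ?thesis
      by (simp add: infsum_not_exists abs_summable_on_def not_integrable_integral_eq)
  qed
  interpret sigma_finite_measure "count_space (UNIV :: 'a set)"
    by (rule sigma_finite_measure_count_space)
  have "(\<lambda>(i, x). f i x) \<in> borel_measurable (count_space UNIV \<Otimes>\<^sub>M M)"
    by (rule measurable_pair_measure_countable1) (use f in auto)
  from measurable_pair_swap[OF this]
  have "(\<lambda>(x, i). f i x) \<in> borel_measurable (M \<Otimes>\<^sub>M count_space UNIV)"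
    by (simp add: case_prod_unfold)
  hence "(\<lambda>x. lebesgue_integral (count_space UNIV) (\<lambda>i. f i x)) \<in> borel_measurable M"
    by (rule borel_measurable_lebesgue_integral)
  thus ?thesis by (simp add: eq)
qed

lemma iter_kernel_measurable:
  fixes c :: "'d::finite \<Rightarrow> int ^ 'd \<Rightarrow> real"
  assumes "dx \<noteq> 0"
  shows "(\<lambda>t. iter_kernel dx c m t \<alpha> \<beta>) \<in> borel_measurable borel"
proof (induction m arbitrary: \<alpha> \<beta>)
  case 0
  show ?case by (simp add: param_kernel_measurable[OF assms])
next
  case (Suc m)
  have K: "(\<lambda>p. param_kernel dx c (fst p - snd p) \<alpha> \<eta>) \<in> borel_measurable (borel \<Otimes>\<^sub>M lborel)" for \<eta>
    by (rule measurable_compose[OF _ param_kernel_measurable[OF assms]]) measurable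
  have I: "(\<lambda>p. iter_kernel dx c m (snd p) \<eta> \<beta>) \<in> borel_measurable (borel \<Otimes>\<^sub>M lborel)" for \<eta>
    by (rule measurable_compose[OF _ Suc.IH]) measurable
  have D: "(\<lambda>p. disc_conv dx (param_kernel dx c (fst p - snd p)) (iter_kernel dx c m (snd p)) \<alpha> \<beta>)
      \<in> borel_measurable (borel \<Otimes>\<^sub>M lborel)"
    unfolding disc_conv_def
    by (intro borel_measurable_infsum borel_measurable_times K I) simp
  have ind: "(\<lambda>p. indicator {0..fst p} (snd p) :: real) \<in> borel_measurable ((borel :: real measure) \<Otimes>\<^sub>M lborel)"
  proof -
    have "(\<lambda>p :: real \<times> real. indicator {0..fst p} (snd p) :: real) =
        (\<lambda>p. if 0 \<le> snd p \<and> snd p \<le> fst p then 1 else 0)"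
      by (auto simp: indicator_def)
    thus ?thesis by (simp only:) measurable
  qed
  have "(\<lambda>(t, s). indicator {0..t} s *\<^sub>R
      disc_conv dx (param_kernel dx c (t - s)) (iter_kernel dx c m s) \<alpha> \<beta>)
      \<in> borel_measurable (borel \<Otimes>\<^sub>M lborel)"
    using borel_measurable_scaleR[OF ind D] by (simp add: case_prod_unfold)
  from lborel.borel_measurable_lebesgue_integral[OF this] show ?case
    by (simp add: set_lebesgue_integral_def)
qed

section \<open>Convergence of the parametrix series\<close>

lemma abs_sums_L1_geometric:
  fixes f :: "nat \<Rightarrow> real \<Rightarrow> real"
  assumes f: "\<And>m. f m \<in> borel_measurable borel"
    and h: "set_integrable lborel {0..T} h"
    and le: "\<And>m t. 0 < t \<Longrightarrow> t \<le> T \<Longrightarrow> \<bar>f m t\<bar> \<le> (1 / 2) ^ m * h t"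
  shows "abs_sums_L1 T f (\<lambda>t. \<Sum>m. f m t)"
proof -
  let ?F = "\<lambda>t. \<Sum>m. f m t"
  have F: "?F \<in> borel_measurable borel" using f by (rule borel_measurable_suminf)
  have tail: "\<bar>?F t - (\<Sum>m<n. f m t)\<bar> \<le> (1 / 2) ^ n * (2 * h t)" if t: "0 < t" "t \<le> T" for n t
  proof -
    have geo: "(\<lambda>m. (1 / 2) ^ n * h t * (1 / 2) ^ m) sums ((1 / 2) ^ n * h t * 2)"
      using sums_mult[OF geometric_sums[of "1 / 2 :: real"]] by simp
    have bnd: "norm (f (m + n) t) \<le> (1 / 2) ^ n * h t * (1 / 2) ^ m" for m
      using le[OF t, of "m + n"] by (simp add: power_add mult_ac)
    have abs: "summable (\<lambda>m. norm (f (m + n) t))"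
      using bnd by (intro summable_comparison_test'[OF sums_summable[OF geo]]) auto
    hence "summable (\<lambda>m. f (m + n) t)" by (rule summable_norm_cancel)
    hence "summable (\<lambda>m. f m t)" using summable_iff_shift[of "\<lambda>m. f m t" n] by simp
    hence "?F t - (\<Sum>m<n. f m t) = (\<Sum>m. f (m + n) t)"
      using suminf_minus_initial_segment[of "\<lambda>m. f m t" n] by simp
    also have "norm \<dots> \<le> (\<Sum>m. norm (f (m + n) t))" by (rule summable_norm[OF abs])
    also have "\<dots> \<le> (1 / 2) ^ n * h t * 2"
      using suminf_le[OF bnd abs sums_summable[OF geo]] sums_unique[OF geo] by simp
    finally show ?thesis by (simp add: mult_ac)
  qed
  have dominated: "set_integrable lborel {0..T} g"
    if g: "g \<in> borel_measurable borel" and k: "\<And>t. 0 < t \<Longrightarrow> t \<le> T \<Longrightarrow> \<bar>g t\<bar> \<le> k * h t" for g k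
  proof -
    have kh: "set_integrable lborel {0..T} (\<lambda>t. k * h t)" using h by simp
    have "AE t in lborel. t \<in> {0..T} \<longrightarrow> \<bar>g t\<bar> \<le> k * h t"
      by (rule AE_lborel_interior) (use k in auto)
    hence "AE t in lborel. norm (indicator {0..T} t *\<^sub>R g t) \<le> norm (indicator {0..T} t *\<^sub>R (k * h t))"
      by eventually_elim (auto simp: indicator_def)
    moreover have "(\<lambda>t. indicator {0..T} t *\<^sub>R g t) \<in> borel_measurable lborel"
      using g by measurable
    ultimately show ?thesis
      using kh unfolding set_integrable_def by (metis Bochner_Integration.integrable_bound)
  qed
  have f_int: "set_integrable lborel {0..T} (f m)" for m
    by (rule dominated[OF f, of _ "(1 / 2) ^ m"]) (rule le)
  have tail_int: "set_integrable lborel {0..T} (\<lambda>t. ?F t - (\<Sum>m<n. f m t))" for n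
    by (rule dominated[of _ "(1 / 2) ^ n * 2"]) (use F f tail in \<open>auto simp: mult.assoc\<close>)
  have norms: "(LBINT t:{0..T}. \<bar>g t\<bar>) \<le> (1 / 2) ^ n * (LBINT t:{0..T}. 2 * h t)"
    if "\<And>t. 0 < t \<Longrightarrow> t \<le> T \<Longrightarrow> \<bar>g t\<bar> \<le> (1 / 2) ^ n * (2 * h t)" for g n
  proof -
    have "\<bar>LBINT t:{0..T}. \<bar>g t\<bar>\<bar> \<le> (LBINT t:{0..T}. (1 / 2) ^ n * (2 * h t))"
      by (rule set_integral_abs_bound) (use h that in auto)
    thus ?thesis by simp
  qed
  have nn: "0 \<le> (LBINT t:{0..T}. \<bar>g t\<bar>)" for g :: "real \<Rightarrow> real"
    unfolding set_lebesgue_integral_def by (intro Bochner_Integration.integral_nonneg) auto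
  have small: "(\<lambda>n. (1 / 2) ^ n * I) \<longlonglongrightarrow> 0" for I :: real
    using tendsto_mult_right[OF LIMSEQ_power_zero[of "1 / 2 :: real"], of I] by simp
  show ?thesis
    unfolding abs_sums_L1_def
  proof (intro conjI allI f_int)
    show "summable (\<lambda>m. LBINT t:{0..T}. \<bar>f m t\<bar>)"
    proof (rule summable_comparison_test')
      show "summable (\<lambda>m. (1 / 2) ^ m * (LBINT t:{0..T}. 2 * h t))"
        by (intro summable_mult2 summable_geometric) auto
      fix m
      have "\<bar>f m t\<bar> \<le> (1 / 2) ^ m * (2 * h t)" if "0 < t" "t \<le> T" for t
        using le[OF that, of m] abs_ge_zero[of "f m t"] by simp
      thus "norm (LBINT t:{0..T}. \<bar>f m t\<bar>) \<le> (1 / 2) ^ m * (LBINT t:{0..T}. 2 * h t)"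
        using norms[of "f m" m] nn[of "f m"] by simp
    qed
    show "set_integrable lborel {0..T} ?F" using tail_int[of 0] by simp
    show "(\<lambda>n. LBINT t:{0..T}. \<bar>?F t - (\<Sum>m<n. f m t)\<bar>) \<longlonglongrightarrow> 0"
      by (rule tendsto_sandwich[OF _ _ tendsto_const small[of "LBINT t:{0..T}. 2 * h t"]])
        (use nn norms tail in auto)
  qed
qed

lemma heat_majorant_le:
  fixes \<alpha> :: "int ^ 'd::finite"
  assumes adm: "admissible dx lo hi L c" and t: "0 < t"
  shows "heat_majorant dx c t \<alpha> \<le> 1 / dx ^ CARD('d)"
proof -
  let ?s = "heat_scale dx c t"
  have s: "0 < ?s" by (rule heat_scale_pos[OF adm t])
  have "profile ?s n \<le> 1" for n
    using profile_le_height[OF s, of n] by (rule order_trans) (simp add: max_def)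
  hence "grid_profile ?s \<alpha> \<le> 1"
    unfolding grid_profile_def by (intro prod_le_1 conjI profile_nonneg s) auto
  thus ?thesis
    unfolding heat_majorant_def using adm by (intro divide_right_mono) (auto simp: admissible_def)
qed

text \<open>
  Coordinate by coordinate: where \<open>\<alpha>\<close> and \<open>\<beta>\<close> agree, the profile divided by \<open>dx\<close> is
  exactly \<open>min (1 / sqrt (2 c)) (sqrt t / dx) / sqrt t\<close>, with \<open>c\<close> the supremum of the coefficients; elsewhere the two sides differ by the factor
  \<open>1 / sqrt (2 c) \<le> 1 / sqrt (2 lo)\<close>.
\<close>
lemma heat_majorant_le_claimed:
  fixes c :: "'d::finite \<Rightarrow> int ^ 'd \<Rightarrow> real"
  assumes adm: "admissible dx lo hi L c" and t: "0 < t"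
  shows "heat_majorant dx c t (\<alpha> - \<beta>) \<le> max 1 (1 / sqrt (2 * lo)) ^ CARD('d) *
    (min (1 / sqrt (2 * coeff_sup c)) (sqrt t / dx) ^ zero_count (\<alpha> - \<beta>) * t powr (- real CARD('d) / 2) *
     (\<Prod>j\<in>UNIV. inverse (1 + (gridpt dx \<alpha> $ j - gridpt dx \<beta> $ j)\<^sup>2 / (2 * coeff_sup c * t))))"
proof -
  define \<kappa> where "\<kappa> = 2 * coeff_sup c"
  define s where "s = heat_scale dx c t"
  define n where "n j = \<alpha> $ j - \<beta> $ j" for j
  define mn where "mn = min (1 / sqrt \<kappa>) (sqrt t / dx)"
  define W where "W = max 1 (1 / sqrt (2 * lo))"
  have dx: "0 < dx" and lo: "0 < lo" using adm by (auto simp: admissible_def)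
  have \<kappa>: "2 * lo \<le> \<kappa>" "0 < \<kappa>"
    using coeff_sup_bounds(2)[OF adm] lo by (auto simp: \<kappa>_def)
  have s: "0 < s" unfolding s_def by (rule heat_scale_pos[OF adm t])
  have s_eq: "s = sqrt \<kappa> * sqrt t / dx" by (simp add: s_def heat_scale_def \<kappa>_def real_sqrt_mult)
  have one: "profile s (n j) / dx \<le> W * ((if n j = 0 then mn else 1) * (1 / sqrt t) *
      inverse (1 + (gridpt dx \<alpha> $ j - gridpt dx \<beta> $ j)\<^sup>2 / (\<kappa> * t)))" for j
  proof -
    have x: "(gridpt dx \<alpha> $ j - gridpt dx \<beta> $ j)\<^sup>2 / (\<kappa> * t) = (of_int (n j))\<^sup>2 / s\<^sup>2"
      using dx t \<kappa> by (simp add: s_eq n_def gridpt_def power_mult_distrib power_divide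
          flip: left_diff_distrib)
    show ?thesis
    proof (cases "n j = 0")
      case True
      have "1 / max 1 s / dx = mn * (1 / sqrt t)"
        using s dx t \<kappa> by (auto simp: s_eq mn_def min_def max_def field_simps)
      moreover have "0 \<le> mn * (1 / sqrt t)" using \<kappa> t dx by (simp add: mn_def)
      hence "1 * (mn * (1 / sqrt t)) \<le> W * (mn * (1 / sqrt t))"
        by (intro mult_right_mono) (auto simp: W_def)
      ultimately show ?thesis using True unfolding x by (simp add: profile_def)
    next
      case False
      let ?i = "inverse (1 + (of_int (n j))\<^sup>2 / s\<^sup>2) :: real"
      have "profile s (n j) / dx = (1 / (s * dx)) * ?i"
        using False s by (simp add: profile_def field_simps power2_eq_square)
      also have "1 / (s * dx) = 1 / sqrt \<kappa> * (1 / sqrt t)" using dx by (simp add: s_eq)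
      also have "\<dots> * ?i \<le> W * (1 / sqrt t) * ?i"
      proof (intro mult_right_mono)
        have "1 / sqrt \<kappa> \<le> 1 / sqrt (2 * lo)" using \<kappa> lo by (intro divide_left_mono) auto
        thus "1 / sqrt \<kappa> \<le> W" by (simp add: W_def)
      qed (use t in auto)
      finally show ?thesis using False unfolding x by simp
    qed
  qed
  have "heat_majorant dx c t (\<alpha> - \<beta>) = (\<Prod>j\<in>UNIV. profile s (n j) / dx)"
    by (simp add: heat_majorant_def grid_profile_def s_def n_def prod_dividef)
  also have "\<dots> \<le> (\<Prod>j\<in>UNIV. W * ((if n j = 0 then mn else 1) * (1 / sqrt t) *
      inverse (1 + (gridpt dx \<alpha> $ j - gridpt dx \<beta> $ j)\<^sup>2 / (\<kappa> * t))))"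
    using one s dx by (intro prod_mono) (auto simp: profile_nonneg)
  also have "\<dots> = W ^ CARD('d) * (mn ^ zero_count (\<alpha> - \<beta>) * (1 / sqrt t) ^ CARD('d) *
      (\<Prod>j\<in>UNIV. inverse (1 + (gridpt dx \<alpha> $ j - gridpt dx \<beta> $ j)\<^sup>2 / (\<kappa> * t))))"
  proof -
    have "(\<Prod>j\<in>UNIV. if n j = 0 then mn else 1) = (\<Prod>j\<in>{j. n j = 0}. mn)"
      by (subst prod.inter_filter[symmetric]) auto
    also have "\<dots> = mn ^ zero_count (\<alpha> - \<beta>)" by (simp add: zero_count_def n_def)
    finally have "(\<Prod>j\<in>UNIV. if n j = 0 then mn else 1) = mn ^ zero_count (\<alpha> - \<beta>)" .
    thus ?thesis by (simp only: prod.distrib prod_constant)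
  qed
  also have "(1 / sqrt t) ^ CARD('d) = t powr (- real CARD('d) / 2)"
  proof -
    have "1 / sqrt t = t powr (- 1 / 2)" using t by (simp add: powr_minus_divide powr_half_sqrt)
    thus ?thesis using t by (simp add: powr_power)
  qed
  finally show ?thesis by (simp add: W_def mn_def \<kappa>_def)
qed

theorem proposition4p2:
  fixes lo hi L :: real
  shows
    "(\<forall>dx. \<forall>c :: 'd::finite \<Rightarrow> int ^ 'd \<Rightarrow> real. admissible dx lo hi L c \<longrightarrow>
       (\<forall>\<alpha> \<beta>.
          (\<forall>T>0. abs_sums_L1 T (\<lambda>m t. iter_kernel dx c m t \<alpha> \<beta>) (\<lambda>t. param_series dx c t \<alpha> \<beta>)) \<and>
          (\<forall>t>0. summable (\<lambda>m. \<bar>iter_kernel dx c m t \<alpha> \<beta>\<bar>)))) \<and>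
     (\<forall>T>0. \<exists>C_T. \<forall>dx. \<forall>c :: 'd \<Rightarrow> int ^ 'd \<Rightarrow> real. admissible dx lo hi L c \<longrightarrow>
       (\<forall>\<alpha> \<beta>. \<forall>t\<in>{0<..T}.
          \<bar>param_series dx c t \<alpha> \<beta>\<bar> \<le>
            C_T * min (1 / sqrt (2 * coeff_sup c)) (sqrt t / dx) ^ zero_count (\<alpha> - \<beta>)
              * t powr (- (real CARD('d) + 1) / 2)
              * (\<Prod>j\<in>UNIV. inverse
                  (1 + (gridpt dx \<alpha> $ j - gridpt dx \<beta> $ j)\<^sup>2 / (2 * coeff_sup c * t)))))"
proof (intro conjI allI impI)
  let ?A = "kernel_const lo hi L CARD('d)"
  fix dx T and c :: "'d \<Rightarrow> int ^ 'd \<Rightarrow> real" and \<alpha> \<beta>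
  assume adm: "admissible dx lo hi L c" and T: "(0::real) < T"
  have dx: "0 < dx" using adm by (simp add: admissible_def)
  obtain \<mu> where lam: "0 < \<mu>" and bound: "\<And>m t. 0 < t \<Longrightarrow> t \<le> T \<Longrightarrow>
      \<bar>iter_kernel dx c m t \<alpha> \<beta>\<bar> \<le> ?A * (1 / 2) ^ m *
        (exp (\<mu> * t) * t powr (- 1 / 2)) * heat_majorant dx c t (\<alpha> - \<beta>)"
    using iter_kernel_bound[OF T, of lo hi L, where 'd = 'd] adm by metis
  define B where "B = \<bar>?A\<bar> * exp (\<mu> * T) / dx ^ CARD('d)"
  have le: "\<bar>iter_kernel dx c m t \<alpha> \<beta>\<bar> \<le> (1 / 2) ^ m * (B * t powr (- 1 / 2))"
    if t: "0 < t" "t \<le> T" for m t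
  proof -
    note H = heat_majorant_nonneg[OF adm t(1), of "\<alpha> - \<beta>"]
    have "?A * (1 / 2) ^ m * (exp (\<mu> * t) * t powr (- 1 / 2)) * heat_majorant dx c t (\<alpha> - \<beta>) \<le>
        \<bar>?A\<bar> * (1 / 2) ^ m * (exp (\<mu> * T) * t powr (- 1 / 2)) * (1 / dx ^ CARD('d))"
      using t lam dx H by (intro mult_mono heat_majorant_le[OF adm]) auto
    with bound[OF t, of m] show ?thesis by (simp add: B_def mult_ac)
  qed
  show "abs_sums_L1 T (\<lambda>m t. iter_kernel dx c m t \<alpha> \<beta>) (\<lambda>t. param_series dx c t \<alpha> \<beta>)"
    unfolding param_series_def
  proof (rule abs_sums_L1_geometric[OF _ _ le])
    show "(\<lambda>t. iter_kernel dx c m t \<alpha> \<beta>) \<in> borel_measurable borel" for m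
      using dx by (intro iter_kernel_measurable) auto
    have "((\<lambda>t. t powr (- 1 / 2)) has_integral T powr (- 1 / 2 + 1) / (- 1 / 2 + 1)) {0..T}"
      using T by (intro has_integral_powr_from_0) auto
    hence "set_integrable lborel {0..T} (\<lambda>t. t powr (- 1 / 2))"
      by (rule lborel_integral_of_has_integral) auto
    thus "set_integrable lborel {0..T} (\<lambda>t. B * t powr (- 1 / 2))" by simp
  qed
  have "summable (\<lambda>m. (1 / 2) ^ m * (B * T powr (- 1 / 2)))"
    by (intro summable_mult2 summable_geometric) auto
  thus "summable (\<lambda>m. \<bar>iter_kernel dx c m T \<alpha> \<beta>\<bar>)"
    by (rule summable_comparison_test') (use le[OF T] in auto)
next
  let ?A = "kernel_const lo hi L CARD('d)"
  fix T :: real assume T: "0 < T"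
  obtain \<mu> where lam: "0 < \<mu>"
    and bound: "\<And>dx (c :: 'd \<Rightarrow> int ^ 'd \<Rightarrow> real) m t \<alpha> \<beta>.
      admissible dx lo hi L c \<Longrightarrow> 0 < t \<Longrightarrow> t \<le> T \<Longrightarrow>
      \<bar>iter_kernel dx c m t \<alpha> \<beta>\<bar> \<le> ?A * (1 / 2) ^ m *
        (exp (\<mu> * t) * t powr (- 1 / 2)) * heat_majorant dx c t (\<alpha> - \<beta>)"
    using iter_kernel_bound[OF T, of lo hi L, where 'd = 'd] by metis
  define W where "W = max 1 (1 / sqrt (2 * lo)) ^ CARD('d)"
  have "\<bar>param_series dx c t \<alpha> \<beta>\<bar> \<le> (2 * \<bar>?A\<bar> * exp (\<mu> * T) * W) *
      min (1 / sqrt (2 * coeff_sup c)) (sqrt t / dx) ^ zero_count (\<alpha> - \<beta>)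
        * t powr (- (real CARD('d) + 1) / 2)
        * (\<Prod>j\<in>UNIV. inverse
            (1 + (gridpt dx \<alpha> $ j - gridpt dx \<beta> $ j)\<^sup>2 / (2 * coeff_sup c * t)))"
    if adm: "admissible dx lo hi L c" and t: "0 < t" "t \<le> T"
    for dx t and c :: "'d \<Rightarrow> int ^ 'd \<Rightarrow> real" and \<alpha> \<beta>
  proof -
    let ?H = "heat_majorant dx c t (\<alpha> - \<beta>)"
    let ?m = "min (1 / sqrt (2 * coeff_sup c)) (sqrt t / dx) ^ zero_count (\<alpha> - \<beta>)"
    let ?P = "\<Prod>j\<in>UNIV. inverse (1 + (gridpt dx \<alpha> $ j - gridpt dx \<beta> $ j)\<^sup>2 / (2 * coeff_sup c * t))"
    note H = heat_majorant_nonneg[OF adm t(1), of "\<alpha> - \<beta>"]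
    define b where "b = \<bar>?A\<bar> * exp (\<mu> * T) * t powr (- 1 / 2) * ?H"
    have le: "norm (iter_kernel dx c m t \<alpha> \<beta>) \<le> b * (1 / 2) ^ m" for m
    proof -
      have "norm (iter_kernel dx c m t \<alpha> \<beta>) \<le>
          ?A * (1 / 2) ^ m * (exp (\<mu> * t) * t powr (- 1 / 2)) * ?H"
        using bound[OF adm t, of m \<alpha> \<beta>] by simp
      also have "\<dots> \<le> \<bar>?A\<bar> * (1 / 2) ^ m * (exp (\<mu> * T) * t powr (- 1 / 2)) * ?H"
        using t lam H by (intro mult_mono) auto
      also have "\<dots> = b * (1 / 2) ^ m" by (simp only: b_def mult_ac)
      finally show ?thesis .
    qed
    have geo: "(\<lambda>m. b * (1 / 2) ^ m) sums (b * 2)"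
      using sums_mult[OF geometric_sums[of "1 / 2 :: real"]] by simp
    have abs: "summable (\<lambda>m. norm (iter_kernel dx c m t \<alpha> \<beta>))"
      using le by (intro summable_comparison_test'[OF sums_summable[OF geo]]) auto
    have "norm (param_series dx c t \<alpha> \<beta>) \<le> (\<Sum>m. norm (iter_kernel dx c m t \<alpha> \<beta>))"
      unfolding param_series_def by (rule summable_norm[OF abs])
    also have "\<dots> \<le> b * 2"
      using suminf_le[OF le abs sums_summable[OF geo]] sums_unique[OF geo] by simp
    also have "\<dots> \<le> \<bar>?A\<bar> * exp (\<mu> * T) * t powr (- 1 / 2) *
        (W * (?m * t powr (- real CARD('d) / 2) * ?P)) * 2"
      unfolding b_def W_def
      by (intro mult_right_mono mult_left_mono heat_majorant_le_claimed[OF adm t(1)]) auto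
    also have "\<dots> = (2 * \<bar>?A\<bar> * exp (\<mu> * T) * W) * ?m * (t powr (- 1 / 2) * t powr (- real CARD('d) / 2)) * ?P"
      by (simp add: mult_ac)
    also have "t powr (- 1 / 2) * t powr (- real CARD('d) / 2) = t powr (- (real CARD('d) + 1) / 2)"
      by (simp add: field_simps flip: powr_add)
    finally show ?thesis by simp
  qed
  thus "\<exists>C_T. \<forall>dx. \<forall>c :: 'd \<Rightarrow> int ^ 'd \<Rightarrow> real. admissible dx lo hi L c \<longrightarrow>
       (\<forall>\<alpha> \<beta>. \<forall>t\<in>{0<..T}.
          \<bar>param_series dx c t \<alpha> \<beta>\<bar> \<le>
            C_T * min (1 / sqrt (2 * coeff_sup c)) (sqrt t / dx) ^ zero_count (\<alpha> - \<beta>)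
              * t powr (- (real CARD('d) + 1) / 2)
              * (\<Prod>j\<in>UNIV. inverse
                  (1 + (gridpt dx \<alpha> $ j - gridpt dx \<beta> $ j)\<^sup>2 / (2 * coeff_sup c * t))))"
    by (intro exI[of _ "2 * \<bar>?A\<bar> * exp (\<mu> * T) * W"]) auto
qed

end
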